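(* Let $X$ be a metric space and $p\ge1$. Then $F_p(X)$ is the free Wasserstein algebra of order $p$ over $X$, with universal arrow the Dirac map $\delta:X\to F_p(X)$. That is, $\delta$ is nonexpansive (indeed an isometric embedding), and for every Wasserstein algebra $B$ of order $p$ and every nonexpansive map $f:X\to B$ there is a unique nonexpansive affine map $\overline{f}:F_p(X)\to B$ with $\overline{f}\circ\delta=f$.
   Context: $F_p(X)$ is the set of finitely supported Borel probability measures on $X$ (finite convex combinations $\sum_i r_i\delta(x_i)$ of Dirac measures), equipped with the Wasserstein metric $\mathrm{W}_p(\mu,\nu)=\left(\inf_\gamma\int d_X^p\,\mathrm{d}\gamma\right)^{1/p}$ (infimum over couplings $\gamma$, i.e.\ probability measures on $X\times X$ with marginals $\mu,\nu$) and the operations $(\mu+_r\nu)(B)=r\mu(B)+(1-r)\nu(B)$, $r\in[0,1]$. A barycentric algebra is a set with binary operations $+_r$ ($r\in[0,1]$) satisfying $x+_1y=x$, $x+_rx=x$, $x+_ry=y+_{1-r}x$, and $(x+_py)+_rz=x+_{pr}(y+_{\frac{r-pr}{1-pr}}z)$ for $r<1,p<1$; affine maps are maps preserving all $+_r$. A Wasserstein algebra of order $p$ is a metric space with nonexpansive operations $+_r:X\times X\to X$ (max metric on the product) forming a barycentric algebra and satisfying $d(x+_ry,x'+_ry')^p\le r\,d(x,x')^p+(1-r)\,d(y,y')^p$ for all $x,x',y,y'$. *)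

theory Defs
  imports "HOL-Probability.Probability"
begin

section \<open>Maps between metric spaces\<close>

definition nonexpansive_map ::
    "'a set \<Rightarrow> ('a \<Rightarrow> 'a \<Rightarrow> real) \<Rightarrow> 'b set \<Rightarrow> ('b \<Rightarrow> 'b \<Rightarrow> real) \<Rightarrow> ('a \<Rightarrow> 'b) \<Rightarrow> bool" where
  "nonexpansive_map M d N e f \<longleftrightarrow>
     f \<in> M \<rightarrow> N \<and> (\<forall>x\<in>M. \<forall>y\<in>M. e (f x) (f y) \<le> d x y)"

definition isometric_embedding ::
    "'a set \<Rightarrow> ('a \<Rightarrow> 'a \<Rightarrow> real) \<Rightarrow> 'b set \<Rightarrow> ('b \<Rightarrow> 'b \<Rightarrow> real) \<Rightarrow> ('a \<Rightarrow> 'b) \<Rightarrow> bool" where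
  "isometric_embedding M d N e f \<longleftrightarrow>
     f \<in> M \<rightarrow> N \<and> (\<forall>x\<in>M. \<forall>y\<in>M. e (f x) (f y) = d x y)"

section \<open>Barycentric and Wasserstein algebras\<close>

text \<open>The operation \<open>x +\<^sub>r y\<close> is written \<open>cc r x y\<close>; only its values for \<open>r\<close> in the unit
  interval and arguments in the carrier matter.\<close>

locale barycentric_algebra =
  fixes A :: "'a set" and cc :: "real \<Rightarrow> 'a \<Rightarrow> 'a \<Rightarrow> 'a"
  assumes closed: "\<And>r x y. \<lbrakk>r \<in> {0..1}; x \<in> A; y \<in> A\<rbrakk> \<Longrightarrow> cc r x y \<in> A"
    and cc_one: "\<And>x y. \<lbrakk>x \<in> A; y \<in> A\<rbrakk> \<Longrightarrow> cc 1 x y = x"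
    and cc_idem: "\<And>r x. \<lbrakk>r \<in> {0..1}; x \<in> A\<rbrakk> \<Longrightarrow> cc r x x = x"
    and cc_commute: "\<And>r x y. \<lbrakk>r \<in> {0..1}; x \<in> A; y \<in> A\<rbrakk> \<Longrightarrow> cc r x y = cc (1 - r) y x"
    and cc_assoc: "\<And>s r x y z. \<lbrakk>s \<in> {0..<1}; r \<in> {0..<1}; x \<in> A; y \<in> A; z \<in> A\<rbrakk> \<Longrightarrow>
       cc r (cc s x y) z = cc (s * r) x (cc ((r - s * r) / (1 - s * r)) y z)"

definition affine_map ::
    "'a set \<Rightarrow> (real \<Rightarrow> 'a \<Rightarrow> 'a \<Rightarrow> 'a) \<Rightarrow> 'b set \<Rightarrow> (real \<Rightarrow> 'b \<Rightarrow> 'b \<Rightarrow> 'b) \<Rightarrow> ('a \<Rightarrow> 'b) \<Rightarrow> bool" where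
  "affine_map A cc B cc' f \<longleftrightarrow>
     f \<in> A \<rightarrow> B \<and>
     (\<forall>r\<in>{0..1}. \<forall>x\<in>A. \<forall>y\<in>A. f (cc r x y) = cc' r (f x) (f y))"

locale wasserstein_algebra = Metric_space A d + barycentric_algebra A cc
  for p :: real
    and A :: "'a set"
    and d :: "'a \<Rightarrow> 'a \<Rightarrow> real"
    and cc :: "real \<Rightarrow> 'a \<Rightarrow> 'a \<Rightarrow> 'a" +
  assumes cc_nonexpansive: "\<And>r. r \<in> {0..1} \<Longrightarrow>
      nonexpansive_map (A \<times> A) (\<lambda>(x, y) (x', y'). max (d x x') (d y y')) A d (\<lambda>(x, y). cc r x y)"
    and cc_wasserstein: "\<And>r x y x' y'. \<lbrakk>r \<in> {0..1}; x \<in> A; y \<in> A; x' \<in> A; y' \<in> A\<rbrakk> \<Longrightarrow>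
      d (cc r x y) (cc r x' y') powr p \<le> r * d x x' powr p + (1 - r) * d y y' powr p"

section \<open>Finitely supported probability measures\<close>

definition borel_of :: "'a topology \<Rightarrow> 'a measure" where
  "borel_of X = sigma (topspace X) {U. openin X U}"

abbreviation mborel :: "'a set \<Rightarrow> ('a \<Rightarrow> 'a \<Rightarrow> real) \<Rightarrow> 'a measure" where
  "mborel M d \<equiv> borel_of (Metric_space.mtopology M d)"

text \<open>Finite sets are closed, hence Borel, so a measure of total mass 1 is finitely supported
  iff some finite subset of the space has mass 1.\<close>

definition fin_prob :: "'a set \<Rightarrow> ('a \<Rightarrow> 'a \<Rightarrow> real) \<Rightarrow> 'a measure set" where
  "fin_prob M d =
     {\<mu>. prob_space \<mu> \<and> sets \<mu> = sets (mborel M d) \<and>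
         (\<exists>S. finite S \<and> S \<subseteq> M \<and> emeasure \<mu> S = 1)}"

definition dirac :: "'a set \<Rightarrow> ('a \<Rightarrow> 'a \<Rightarrow> real) \<Rightarrow> 'a \<Rightarrow> 'a measure" where
  "dirac M d x = return (mborel M d) x"

definition cc_measure :: "real \<Rightarrow> 'a measure \<Rightarrow> 'a measure \<Rightarrow> 'a measure" where
  "cc_measure r \<mu> \<nu> =
     measure_of (space \<mu>) (sets \<mu>)
       (\<lambda>B. ennreal r * emeasure \<mu> B + ennreal (1 - r) * emeasure \<nu> B)"

lemma emeasure_cc_measure:
  assumes "sets \<nu> = sets \<mu>" "B \<in> sets \<mu>"
  shows "emeasure (cc_measure r \<mu> \<nu>) B = ennreal r * emeasure \<mu> B + ennreal (1 - r) * emeasure \<nu> B"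
  unfolding cc_measure_def
proof (rule emeasure_measure_of_sigma[OF sets.sigma_algebra_axioms _ _ assms(2)])
  show "positive (sets \<mu>) (\<lambda>B. ennreal r * emeasure \<mu> B + ennreal (1 - r) * emeasure \<nu> B)"
    by (simp add: positive_def)
  show "countably_additive (sets \<mu>) (\<lambda>B. ennreal r * emeasure \<mu> B + ennreal (1 - r) * emeasure \<nu> B)"
  proof (rule countably_additiveI)
    fix F :: "nat \<Rightarrow> 'a set"
    assume F: "range F \<subseteq> sets \<mu>" "disjoint_family F"
    have "(\<Sum>i. ennreal r * emeasure \<mu> (F i) + ennreal (1 - r) * emeasure \<nu> (F i))
        = ennreal r * (\<Sum>i. emeasure \<mu> (F i)) + ennreal (1 - r) * (\<Sum>i. emeasure \<nu> (F i))"
      by (simp add: suminf_add[symmetric])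
    then show "(\<Sum>i. ennreal r * emeasure \<mu> (F i) + ennreal (1 - r) * emeasure \<nu> (F i))
        = ennreal r * emeasure \<mu> (\<Union>i. F i) + ennreal (1 - r) * emeasure \<nu> (\<Union>i. F i)"
      using F assms(1) by (simp add: suminf_emeasure)
  qed
qed

section \<open>The Wasserstein metric\<close>

text \<open>Couplings live on the Borel sigma-algebra of the product space. For non-separable spaces
  it can be strictly larger than the product sigma-algebra of \<open>\<Otimes>\<^sub>M\<close>, with respect to which
  the metric need not even be measurable.\<close>

definition couplings ::
    "'a set \<Rightarrow> ('a \<Rightarrow> 'a \<Rightarrow> real) \<Rightarrow> 'a measure \<Rightarrow> 'a measure \<Rightarrow> ('a \<times> 'a) measure set" where
  "couplings M d \<mu> \<nu> =
     {\<gamma>. prob_space \<gamma> \<and>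
         sets \<gamma> = sets (borel_of (prod_topology (Metric_space.mtopology M d) (Metric_space.mtopology M d))) \<and>
         distr \<gamma> (mborel M d) fst = \<mu> \<and> distr \<gamma> (mborel M d) snd = \<nu>}"

text \<open>The infimum is taken in the extended nonnegative reals; it is finite for
  finitely supported measures.\<close>

definition wasserstein ::
    "real \<Rightarrow> 'a set \<Rightarrow> ('a \<Rightarrow> 'a \<Rightarrow> real) \<Rightarrow> 'a measure \<Rightarrow> 'a measure \<Rightarrow> real" where
  "wasserstein p M d \<mu> \<nu> =
     enn2real (INF \<gamma>\<in>couplings M d \<mu> \<nu>. \<integral>\<^sup>+ z. ennreal (d (fst z) (snd z) powr p) \<partial>\<gamma>) powr (1 / p)"

end

theory Submission
  imports Defs "HOL-Algebra.FiniteProduct"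
begin

text \<open>Every coupling of two finitely supported measures is concentrated on a finite set, so the
  Wasserstein distance is an infimum of costs of finite transport plans. Gluing plans and the
  convexity of \<open>t \<mapsto> t\<^sup>p\<close> give the triangle inequality; convex combinations of plans give the
  Wasserstein inequality.

  For the universal property, a barycentric algebra \<open>B\<close> is embedded at height 1 into the cone of
  massive points of \<open>B\<close>, a commutative monoid. Finite convex combinations thereby become finite
  sums in a commutative monoid, whose invariance under regrouping makes the extension
  \<open>\<Sum> r\<^sub>i \<delta>(x\<^sub>i) \<mapsto> \<Sum> r\<^sub>i f(x\<^sub>i)\<close> well defined and affine. A plan expresses the values at
  \<open>\<mu>\<close> and \<open>\<nu>\<close> as combinations with the same weights, and iterating the Wasserstein inequality of
  \<open>B\<close> bounds their distance by the cost of the plan.\<close>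

section \<open>Borel sets of a topological space\<close>

text \<open>The infimum defining the distance is never shown to be attained: near-optimal plans come
  with a strict bound. Hence the slack \<open>e\<close> in the triangle and Wasserstein
  inequalities. Hence also separation cannot be read off from an optimal plan: it needs a uniform
  positive lower bound on the cost, obtained from the least positive distance between atoms.
  Iterated convex combinations in \<open>B\<close> renormalise the remaining weights at each stage,
  which fails once the remaining weight is 0 and a priori depends on the order of the points. Points
  with unnormalised masses avoid both: masses simply add, ratios are formed only for positive
  masses, and the value in \<open>B\<close> is read off at the end, at total mass 1. Finitely
  supported measures are determined by the masses of singletons, so identities between them become
  identities between real numbers.\<close>

lemma space_borel_of: "space (borel_of T) = topspace T"
  by (simp add: borel_of_def space_measure_of_conv)

lemma sets_borel_of: "sets (borel_of T) = sigma_sets (topspace T) {U. openin T U}"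
  unfolding borel_of_def by (rule sets_measure_of) (auto dest: openin_subset)

lemma openin_sets_borel_of: "openin T U \<Longrightarrow> U \<in> sets (borel_of T)"
  by (simp add: sets_borel_of sigma_sets.Basic)

lemma closedin_sets_borel_of:
  assumes "closedin T C"
  shows "C \<in> sets (borel_of T)"
proof -
  have "topspace T - (topspace T - C) \<in> sets (borel_of T)"
    using assms openin_sets_borel_of[of T "topspace T - C"] sets.compl_sets[of _ "borel_of T"]
    by (simp add: space_borel_of closedin_def)
  then show ?thesis
    using closedin_subset[OF assms] by (simp add: double_diff)
qed

lemma finite_sets_borel_of:
  assumes "t1_space T" "finite S" "S \<subseteq> topspace T"
  shows "S \<in> sets (borel_of T)"
  using assms by (simp add: closedin_sets_borel_of t1_space_closedin_finite)

lemma measurable_borel_of: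
  assumes "continuous_map S T f"
  shows "f \<in> borel_of S \<rightarrow>\<^sub>M borel_of T"
  unfolding borel_of_def[of T]
proof (rule measurable_measure_of)
  show "{U. openin T U} \<subseteq> Pow (topspace T)"
    by (auto dest: openin_subset)
  show "f \<in> space (borel_of S) \<rightarrow> topspace T"
    using assms by (auto simp: space_borel_of continuous_map_def)
  show "f -` y \<inter> space (borel_of S) \<in> sets (borel_of S)" if "y \<in> {U. openin T U}" for y
  proof -
    have "f -` y \<inter> space (borel_of S) = {x \<in> topspace S. f x \<in> y}"
      by (auto simp: space_borel_of)
    then show ?thesis
      using that assms by (simp add: continuous_map_def openin_sets_borel_of)
  qed
qed

lemma borel_measurable_borel_of:
  assumes "continuous_map S euclidean f"
  shows "f \<in> borel_measurable (borel_of S)"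
proof (rule borel_measurableI)
  fix U :: "'b set" assume "open U"
  moreover have "f -` U \<inter> space (borel_of S) = {x \<in> topspace S. f x \<in> U}"
    by (auto simp: space_borel_of)
  ultimately show "f -` U \<inter> space (borel_of S) \<in> sets (borel_of S)"
    using assms by (simp add: continuous_map_def openin_sets_borel_of)
qed

section \<open>Measures with finite support\<close>

text \<open>The combination of Dirac measures at the points \<open>a k\<close> with coefficients
  \<open>w k\<close>. As a pushforward from the index set it adds up the weights of repeated points
  by itself, and a further pushforward merely composes with \<open>a\<close>.\<close>

definition weighted_measure ::
    "'k set \<Rightarrow> ('k \<Rightarrow> real) \<Rightarrow> ('k \<Rightarrow> 'a) \<Rightarrow> 'a measure \<Rightarrow> 'a measure" where
  "weighted_measure I w a N = distr (point_measure I (\<lambda>k. ennreal (w k))) N a"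

lemma sets_weighted_measure [simp]: "sets (weighted_measure I w a N) = sets N"
  and space_weighted_measure [simp]: "space (weighted_measure I w a N) = space N"
  by (simp_all add: weighted_measure_def)

lemma emeasure_weighted_measure:
  assumes "finite I" "\<forall>k\<in>I. 0 \<le> w k" "a \<in> I \<rightarrow> space N" "A \<in> sets N"
  shows "emeasure (weighted_measure I w a N) A = ennreal (\<Sum>k\<in>{k\<in>I. a k \<in> A}. w k)"
proof -
  have "a -` A \<inter> I = {k\<in>I. a k \<in> A}" by auto
  moreover have "(\<Sum>k\<in>{k\<in>I. a k \<in> A}. ennreal (w k)) = ennreal (\<Sum>k\<in>{k\<in>I. a k \<in> A}. w k)"
    using assms(2) by (intro sum_ennreal) auto
  ultimately show ?thesis
    using assms unfolding weighted_measure_def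
    by (simp add: emeasure_distr space_point_measure emeasure_point_measure_finite)
qed

lemma measure_weighted_measure:
  assumes "finite I" "\<forall>k\<in>I. 0 \<le> w k" "a \<in> I \<rightarrow> space N" "A \<in> sets N"
  shows "measure (weighted_measure I w a N) A = (\<Sum>k\<in>{k\<in>I. a k \<in> A}. w k)"
proof -
  have "0 \<le> (\<Sum>k\<in>{k\<in>I. a k \<in> A}. w k)"
    using assms(2) by (intro sum_nonneg) auto
  then show ?thesis
    using emeasure_weighted_measure[OF assms] by (simp add: measure_def)
qed

lemma prob_space_weighted_measure:
  assumes "finite I" "\<forall>k\<in>I. 0 \<le> w k" "a \<in> I \<rightarrow> space N" "sum w I = 1"
  shows "prob_space (weighted_measure I w a N)"
proof
  have "{k \<in> I. a k \<in> space N} = I" using assms(3) by auto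
  then show "emeasure (weighted_measure I w a N) (space (weighted_measure I w a N)) = 1"
    using assms emeasure_weighted_measure[OF assms(1-3), of "space N"] by simp
qed

lemma nn_integral_weighted_measure:
  assumes "finite I" "\<forall>k\<in>I. 0 \<le> w k" "a \<in> I \<rightarrow> space N"
    and "g \<in> borel_measurable N" "\<And>x. 0 \<le> g x"
  shows "(\<integral>\<^sup>+x. ennreal (g x) \<partial>weighted_measure I w a N) = ennreal (\<Sum>k\<in>I. w k * g (a k))"
proof -
  have "(\<integral>\<^sup>+x. ennreal (g x) \<partial>weighted_measure I w a N) = (\<Sum>k\<in>I. ennreal (w k) * ennreal (g (a k)))"
    unfolding weighted_measure_def using assms
    by (simp add: nn_integral_distr nn_integral_point_measure_finite)
  also have "\<dots> = ennreal (\<Sum>k\<in>I. w k * g (a k))"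
    using assms by (simp add: ennreal_mult' sum_ennreal[symmetric])
  finally show ?thesis .
qed

lemma distr_weighted_measure:
  assumes "a \<in> I \<rightarrow> space N" "h \<in> N \<rightarrow>\<^sub>M K"
  shows "distr (weighted_measure I w a N) K h = weighted_measure I w (\<lambda>k. h (a k)) K"
  unfolding weighted_measure_def using assms by (simp add: distr_distr comp_def)

text \<open>Almost everywhere the integrand agrees with a finite combination of indicators of
  singletons, which is measurable whatever \<open>g\<close> is.\<close>

lemma (in finite_measure) nn_integral_finite_support:
  assumes F: "finite F" "\<And>x. x \<in> F \<Longrightarrow> {x} \<in> sets M" "AE x in M. x \<in> F"
    and g: "\<And>x. 0 \<le> g x"
  shows "(\<integral>\<^sup>+x. ennreal (g x) \<partial>M) = ennreal (\<Sum>x\<in>F. measure M {x} * g x)"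
proof -
  have "(\<integral>\<^sup>+x. ennreal (g x) \<partial>M) = (\<integral>\<^sup>+x. (\<Sum>z\<in>F. ennreal (g z) * indicator {z} x) \<partial>M)"
  proof (rule nn_integral_cong_AE, use F(3) in eventually_elim)
    case (elim x)
    have "(\<Sum>z\<in>F. ennreal (g z) * indicator {z} x) = (\<Sum>z\<in>F. if z = x then ennreal (g z) else 0)"
      by (intro sum.cong) auto
    then show ?case using elim F(1) by simp
  qed
  also have "\<dots> = (\<Sum>z\<in>F. ennreal (g z) * emeasure M {z})"
    using F(2) by (subst nn_integral_sum) (auto simp: nn_integral_cmult_indicator)
  also have "\<dots> = (\<Sum>z\<in>F. ennreal (measure M {z} * g z))"
    by (simp add: emeasure_eq_measure ennreal_mult' g mult.commute)
  also have "\<dots> = ennreal (\<Sum>x\<in>F. measure M {x} * g x)"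
    using g by (simp add: sum_ennreal)
  finally show ?thesis .
qed

context Metric_space
begin

lemma space_mborel: "space (mborel M d) = M"
  by (simp add: space_borel_of)

lemma space_mborel_prod: "space (borel_of (prod_topology mtopology mtopology)) = M \<times> M"
  by (simp add: space_borel_of)

lemma finite_sets_mborel: "finite S \<Longrightarrow> S \<subseteq> M \<Longrightarrow> S \<in> sets (mborel M d)"
  by (rule finite_sets_borel_of) (auto simp: Hausdorff_imp_t1_space Hausdorff_space_mtopology)

lemma finite_sets_mborel_prod:
  "finite S \<Longrightarrow> S \<subseteq> M \<times> M \<Longrightarrow> S \<in> sets (borel_of (prod_topology mtopology mtopology))"
  by (rule finite_sets_borel_of)
    (auto simp: Hausdorff_imp_t1_space Hausdorff_space_prod_topology Hausdorff_space_mtopology)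

lemma measurable_fst_mborel: "fst \<in> borel_of (prod_topology mtopology mtopology) \<rightarrow>\<^sub>M mborel M d"
  and measurable_snd_mborel: "snd \<in> borel_of (prod_topology mtopology mtopology) \<rightarrow>\<^sub>M mborel M d"
  and measurable_swap_mborel: "prod.swap \<in> borel_of (prod_topology mtopology mtopology)
        \<rightarrow>\<^sub>M borel_of (prod_topology mtopology mtopology)"
  by (auto intro!: measurable_borel_of continuous_map_fst continuous_map_snd continuous_map_pairedI
      simp: prod.swap_def[abs_def])

lemma borel_measurable_dist:
  "(\<lambda>z. d (fst z) (snd z)) \<in> borel_measurable (borel_of (prod_topology mtopology mtopology))"
proof (rule borel_measurable_borel_of)
  show "continuous_map (prod_topology mtopology mtopology) euclidean (\<lambda>z. d (fst z) (snd z))"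
    using continuous_map_mdist[of "prod_topology mtopology mtopology" Self fst snd]
    by (simp add: Self_def continuous_map_fst continuous_map_snd)
qed

section \<open>Finitely supported measures as finite families of point masses\<close>

lemma fin_probD:
  assumes "\<mu> \<in> fin_prob M d"
  shows "prob_space \<mu>" "sets \<mu> = sets (mborel M d)" "space \<mu> = M"
  using assms sets_eq_imp_space_eq[of \<mu> "mborel M d"] by (auto simp: fin_prob_def space_mborel)

lemma measure_cc_measure:
  assumes "r \<in> {0..1}" "\<mu> \<in> fin_prob M d" "\<nu> \<in> fin_prob M d" "A \<in> sets (mborel M d)"
  shows "measure (cc_measure r \<mu> \<nu>) A = r * measure \<mu> A + (1 - r) * measure \<nu> A"
proof -
  interpret \<mu>: prob_space \<mu> using assms(2) by (rule fin_probD)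
  interpret \<nu>: prob_space \<nu> using assms(3) by (rule fin_probD)
  have "emeasure (cc_measure r \<mu> \<nu>) A = ennreal (r * measure \<mu> A) + ennreal ((1 - r) * measure \<nu> A)"
    using assms by (simp add: emeasure_cc_measure fin_probD \<mu>.emeasure_eq_measure
        \<nu>.emeasure_eq_measure ennreal_mult')
  also have "\<dots> = ennreal (r * measure \<mu> A + (1 - r) * measure \<nu> A)"
    using assms(1) by (subst ennreal_plus) auto
  finally have "emeasure (cc_measure r \<mu> \<nu>) A = ennreal (r * measure \<mu> A + (1 - r) * measure \<nu> A)" .
  then show ?thesis
    using assms(1) by (intro measure_eq_emeasure_eq_ennreal) auto
qed

definition mass_support :: "'a measure \<Rightarrow> 'a set" where
  "mass_support \<mu> = {x \<in> M. measure \<mu> {x} \<noteq> 0}"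

lemma mass_support_subset: "mass_support \<mu> \<subseteq> M"
  by (auto simp: mass_support_def)

text \<open>All atoms lie in any finite set of mass 1, because its complement is null. The carrier
  \<open>S\<close> may be any finite superset of the atoms, so that sums for different measures can
  be taken over a common set.\<close>

lemma
  assumes "\<mu> \<in> fin_prob M d"
  shows finite_mass_support: "finite (mass_support \<mu>)"
    and measure_fin_prob: "\<lbrakk>finite S; mass_support \<mu> \<subseteq> S; S \<subseteq> M; A \<in> sets (mborel M d)\<rbrakk> \<Longrightarrow>
      measure \<mu> A = (\<Sum>x\<in>S \<inter> A. measure \<mu> {x})"
proof -
  interpret prob_space \<mu> using assms by (rule fin_probD)
  note \<mu> = fin_probD[OF assms]
  obtain S0 where S0: "finite S0" "S0 \<subseteq> M" "emeasure \<mu> S0 = 1"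
    using assms by (auto simp: fin_prob_def)
  have ev: "S \<in> events" if "finite S" "S \<subseteq> M" for S
    using that by (simp add: \<mu> finite_sets_mborel)
  have prob_S0: "prob S0 = 1" using S0(3) by (simp add: measure_def)
  have compl: "prob (space \<mu> - S0) = 0"
    using prob_compl[of S0] ev S0 prob_S0 by simp
  \<comment> \<open>A non-measurable set has \<open>prob\<close> equal to 0 by convention, so this
    covers every set disjoint from \<open>S0\<close>.\<close>
  have null: "prob A = 0" if "A \<inter> S0 = {}" for A
  proof (cases "A \<in> events")
    case True
    then have "A \<subseteq> space \<mu> - S0" using that sets.sets_into_space by blast
    then have "prob A \<le> prob (space \<mu> - S0)"
      using ev S0 by (intro finite_measure_mono) auto
    then show ?thesis using compl measure_nonneg[of \<mu> A] by linarith
  qed (simp add: measure_notin_sets)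
  have supp: "mass_support \<mu> \<subseteq> S0"
    using null[of "{_}"] by (auto simp: mass_support_def)
  then show "finite (mass_support \<mu>)" using S0(1) finite_subset by blast
  show "measure \<mu> A = (\<Sum>x\<in>S \<inter> A. measure \<mu> {x})"
    if S: "finite S" "mass_support \<mu> \<subseteq> S" "S \<subseteq> M" "A \<in> sets (mborel M d)" for S A
  proof -
    have A: "A \<in> events" using S \<mu> by simp
    have "prob A = prob (A \<inter> S0) + prob (A - S0)"
      using A ev S0 by (metis finite_measure_Diff' add.commute diff_add_cancel)
    also have "\<dots> = (\<Sum>x\<in>A \<inter> S0. prob {x})"
      using null[of "A - S0"] S0 ev by (subst finite_measure_eq_sum_singleton) auto
    also have "\<dots> = (\<Sum>x\<in>A \<inter> mass_support \<mu>. prob {x})"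
      using S0 supp by (intro sum.mono_neutral_right) (auto simp: mass_support_def)
    also have "\<dots> = (\<Sum>x\<in>S \<inter> A. measure \<mu> {x})"
      using S by (intro sum.mono_neutral_left) (auto simp: mass_support_def)
    finally show ?thesis .
  qed
qed

lemma sum_masses:
  assumes "\<mu> \<in> fin_prob M d" "finite S" "mass_support \<mu> \<subseteq> S" "S \<subseteq> M"
  shows "(\<Sum>x\<in>S. measure \<mu> {x}) = 1"
proof -
  interpret prob_space \<mu> using assms(1) by (rule fin_probD)
  have "M \<in> sets (mborel M d)" using sets.top[of "mborel M d"] by (simp add: space_mborel)
  then show ?thesis
    using measure_fin_prob[OF assms, of M] prob_space fin_probD[OF assms(1)] assms(4)
    by (simp add: Int_absorb2)
qed

text \<open>Both measures of a set are sums over the same finite set of atoms. This is the tool by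
  which the barycentric axioms are checked on point masses.\<close>

lemma fin_prob_eqI:
  assumes "\<mu> \<in> fin_prob M d" "\<nu> \<in> fin_prob M d"
    and "\<And>x. x \<in> M \<Longrightarrow> measure \<mu> {x} = measure \<nu> {x}"
  shows "\<mu> = \<nu>"
proof (rule measure_eqI)
  show "sets \<mu> = sets \<nu>" using assms by (simp add: fin_probD)
  fix A assume A: "A \<in> sets \<mu>"
  interpret \<mu>: prob_space \<mu> using assms(1) by (rule fin_probD)
  interpret \<nu>: prob_space \<nu> using assms(2) by (rule fin_probD)
  have supp: "mass_support \<mu> = mass_support \<nu>" using assms(3) by (auto simp: mass_support_def)
  have "measure \<mu> A = (\<Sum>x\<in>mass_support \<mu> \<inter> A. measure \<mu> {x})"
    using A fin_probD[OF assms(1)] finite_mass_support[OF assms(1)]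
    by (intro measure_fin_prob[OF assms(1)]) (auto simp: mass_support_subset)
  also have "\<dots> = (\<Sum>x\<in>mass_support \<nu> \<inter> A. measure \<nu> {x})"
    using assms(3) supp mass_support_subset[of \<nu>] by (intro sum.cong) auto
  also have "\<dots> = measure \<nu> A"
    using A fin_probD[OF assms(1)] finite_mass_support[OF assms(2)]
    by (intro measure_fin_prob[OF assms(2), symmetric]) (auto simp: mass_support_subset)
  finally show "emeasure \<mu> A = emeasure \<nu> A"
    by (simp add: \<mu>.emeasure_eq_measure \<nu>.emeasure_eq_measure)
qed

lemma weighted_measure_fin_prob:
  assumes "finite I" "\<forall>k\<in>I. 0 \<le> w k" "a \<in> I \<rightarrow> M" "sum w I = 1"
  shows "weighted_measure I w a (mborel M d) \<in> fin_prob M d"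
proof -
  have a: "a \<in> I \<rightarrow> space (mborel M d)" using assms(3) by (simp add: space_mborel)
  have fin: "finite (a ` I)" "a ` I \<subseteq> M" using assms by auto
  have "{k \<in> I. a k \<in> a ` I} = I" by auto
  then have "emeasure (weighted_measure I w a (mborel M d)) (a ` I) = 1"
    using emeasure_weighted_measure[OF assms(1,2) a finite_sets_mborel[OF fin]] assms(4) by simp
  with fin show ?thesis
    unfolding fin_prob_def using prob_space_weighted_measure[OF assms(1,2) a assms(4)] by auto
qed

lemma measure_weighted_singleton:
  assumes "finite I" "\<forall>k\<in>I. 0 \<le> w k" "a \<in> I \<rightarrow> M" "x \<in> M"
  shows "measure (weighted_measure I w a (mborel M d)) {x} = (\<Sum>k\<in>{k\<in>I. a k = x}. w k)"
  using measure_weighted_measure[of I w a "mborel M d" "{x}"] assms finite_sets_mborel[of "{x}"]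
  by (simp add: space_mborel)

section \<open>Convex combinations and the barycentric axioms\<close>

lemma fin_prob_cc_measure:
  assumes "r \<in> {0..1}" "\<mu> \<in> fin_prob M d" "\<nu> \<in> fin_prob M d"
  shows "cc_measure r \<mu> \<nu> \<in> fin_prob M d"
proof -
  interpret \<mu>: prob_space \<mu> using assms(2) by (rule fin_probD)
  interpret \<nu>: prob_space \<nu> using assms(3) by (rule fin_probD)
  note \<mu> = fin_probD[OF assms(2)] and \<nu> = fin_probD[OF assms(3)]
  have sets_eq: "sets (cc_measure r \<mu> \<nu>) = sets (mborel M d)"
    using sets.space_closed[of \<mu>] sets.sigma_sets_eq[of \<mu>] \<mu>(2)
    by (simp add: cc_measure_def sets_measure_of)
  \<comment> \<open>Used twice: for the union of the supports, which gives finite support, and for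
    the whole space, which gives total mass 1.\<close>
  have one: "emeasure (cc_measure r \<mu> \<nu>) A = 1"
    if "A \<in> sets (mborel M d)" "measure \<mu> A = 1" "measure \<nu> A = 1" for A
  proof -
    have "emeasure (cc_measure r \<mu> \<nu>) A = ennreal r + ennreal (1 - r)"
      using that by (simp add: emeasure_cc_measure \<mu> \<nu> \<mu>.emeasure_eq_measure \<nu>.emeasure_eq_measure)
    also have "\<dots> = ennreal (r + (1 - r))"
      using assms(1) by (subst ennreal_plus) auto
    finally show ?thesis by simp
  qed
  let ?S = "mass_support \<mu> \<union> mass_support \<nu>"
  have S: "finite ?S" "?S \<subseteq> M"
    using assms finite_mass_support mass_support_subset by auto
  have "measure \<mu> ?S = 1" "measure \<nu> ?S = 1"
    using measure_fin_prob[OF assms(2) S(1) _ S(2), of ?S] measure_fin_prob[OF assms(3) S(1) _ S(2), of ?S]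
      sum_masses[OF assms(2) S(1) _ S(2)] sum_masses[OF assms(3) S(1) _ S(2)] finite_sets_mborel[OF S]
    by simp_all
  then have "emeasure (cc_measure r \<mu> \<nu>) ?S = 1"
    by (intro one finite_sets_mborel S)
  moreover have "emeasure (cc_measure r \<mu> \<nu>) (space (cc_measure r \<mu> \<nu>)) = 1"
    using \<mu>.prob_space \<nu>.prob_space sets_eq_imp_space_eq[OF sets_eq] sets.top[of "mborel M d"]
    by (intro one) (auto simp: \<mu> \<nu> space_mborel)
  ultimately show ?thesis
    unfolding fin_prob_def using S sets_eq by (auto intro!: prob_spaceI)
qed

lemma measure_dirac: "x \<in> M \<Longrightarrow> y \<in> M \<Longrightarrow> measure (dirac M d x) {y} = (if y = x then 1 else 0)"
  using finite_sets_mborel[of "{y}"] by (simp add: dirac_def measure_return indicator_def)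

lemma fin_prob_dirac:
  assumes "x \<in> M"
  shows "dirac M d x \<in> fin_prob M d"
proof -
  have "emeasure (dirac M d x) {x} = 1"
    using assms finite_sets_mborel[of "{x}"] by (simp add: dirac_def)
  then have "\<exists>S. finite S \<and> S \<subseteq> M \<and> emeasure (dirac M d x) S = 1"
    using assms by (intro exI[of _ "{x}"]) auto
  then show ?thesis
    using assms by (simp add: fin_prob_def dirac_def prob_space_return space_mborel)
qed

lemma barycentric_fin_prob: "barycentric_algebra (fin_prob M d) cc_measure"
proof
  show "cc_measure r \<mu> \<nu> \<in> fin_prob M d"
    if "r \<in> {0..1}" "\<mu> \<in> fin_prob M d" "\<nu> \<in> fin_prob M d" for r \<mu> \<nu>
    using that by (rule fin_prob_cc_measure)
  note singleton = finite_sets_mborel[OF finite.insertI[OF finite.emptyI]]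
  show "cc_measure 1 \<mu> \<nu> = \<mu>" if "\<mu> \<in> fin_prob M d" "\<nu> \<in> fin_prob M d" for \<mu> \<nu>
    using that by (intro fin_prob_eqI) (auto simp: fin_prob_cc_measure measure_cc_measure singleton)
  show "cc_measure r \<mu> \<mu> = \<mu>" if "r \<in> {0..1}" "\<mu> \<in> fin_prob M d" for r \<mu>
    using that by (intro fin_prob_eqI)
      (auto simp: fin_prob_cc_measure measure_cc_measure singleton algebra_simps)
  show "cc_measure r \<mu> \<nu> = cc_measure (1 - r) \<nu> \<mu>"
    if "r \<in> {0..1}" "\<mu> \<in> fin_prob M d" "\<nu> \<in> fin_prob M d" for r \<mu> \<nu>
    using that by (intro fin_prob_eqI) (auto simp: fin_prob_cc_measure measure_cc_measure singleton)
  show "cc_measure r (cc_measure s \<mu> \<nu>) \<rho>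
      = cc_measure (s * r) \<mu> (cc_measure ((r - s * r) / (1 - s * r)) \<nu> \<rho>)"
    if sr: "s \<in> {0..<1}" "r \<in> {0..<1}"
      and m: "\<mu> \<in> fin_prob M d" "\<nu> \<in> fin_prob M d" "\<rho> \<in> fin_prob M d" for s r \<mu> \<nu> \<rho>
  proof (rule fin_prob_eqI)
    have le: "s * r \<le> r" "0 \<le> s * r" using sr by (auto simp: mult_left_le_one_le)
    then have lt: "s * r < 1" using sr by auto
    define t where "t = (r - s * r) / (1 - s * r)"
    have t: "t \<in> {0..1}" "(1 - s * r) * t = r - s * r" using le lt sr by (auto simp: t_def divide_simps)
    have mem: "s * r \<in> {0..1}" "s \<in> {0..1}" "r \<in> {0..1}" using le lt sr by auto
    show "cc_measure r (cc_measure s \<mu> \<nu>) \<rho> \<in> fin_prob M d"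
      using mem m by (simp add: fin_prob_cc_measure)
    show "cc_measure (s * r) \<mu> (cc_measure ((r - s * r) / (1 - s * r)) \<nu> \<rho>) \<in> fin_prob M d"
      using mem m t unfolding t_def[symmetric] by (simp add: fin_prob_cc_measure)
    fix x assume x: "x \<in> M"
    \<comment> \<open>Both bracketings give the weights \<open>s * r\<close>,
      \<open>r - s * r\<close> and \<open>1 - r\<close> to the three measures; this identity
      accounts for the last two.\<close>
    have "(1 - s * r) * (t * b + (1 - t) * c) = (r - s * r) * b + (1 - r) * c" for b c
    proof -
      have "(1 - s * r) * (t * b + (1 - t) * c) = ((1 - s * r) * t) * b + (1 - s * r - (1 - s * r) * t) * c"
        by (simp add: algebra_simps)
      then show ?thesis unfolding t by simp
    qed
    from this[of "measure \<nu> {x}" "measure \<rho> {x}"]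
    show "measure (cc_measure r (cc_measure s \<mu> \<nu>) \<rho>) {x}
        = measure (cc_measure (s * r) \<mu> (cc_measure ((r - s * r) / (1 - s * r)) \<nu> \<rho>)) {x}"
      unfolding t_def[symmetric] using mem m t x
      by (simp add: measure_cc_measure fin_prob_cc_measure singleton algebra_simps)
  qed
qed

end

section \<open>The cone over a barycentric algebra\<close>

context barycentric_algebra
begin

lemma cc_zero: "x \<in> A \<Longrightarrow> y \<in> A \<Longrightarrow> cc 0 x y = y"
  using cc_commute[of 0 x y] by (simp add: cc_one)

text \<open>The cone over \<open>A\<close> consists of the points of \<open>A\<close> carrying a positive mass, together with a
  massless element, encoded as \<open>(0, undefined)\<close>. Its addition forms centres of mass; the barycentric
  axioms are precisely what makes it commutative and associative.\<close>

definition weighted :: "real \<Rightarrow> 'a \<Rightarrow> real \<times> 'a" where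
  "weighted r x = (if r = 0 then (0, undefined) else (r, x))"

definition mass_cone :: "(real \<times> 'a) monoid" where
  "mass_cone = \<lparr>carrier = insert (0, undefined) ({0<..} \<times> A),
     monoid.mult = (\<lambda>u v. if fst u = 0 then v else if fst v = 0 then u
       else (fst u + fst v, cc (fst u / (fst u + fst v)) (snd u) (snd v))),
     one = (0, undefined)\<rparr>"

lemma carrier_mass_cone: "carrier mass_cone = insert (0, undefined) ({0<..} \<times> A)"
  and one_mass_cone: "\<one>\<^bsub>mass_cone\<^esub> = (0, undefined)"
  and mult_mass_cone: "u \<otimes>\<^bsub>mass_cone\<^esub> v = (if fst u = 0 then v else if fst v = 0 then u
       else (fst u + fst v, cc (fst u / (fst u + fst v)) (snd u) (snd v)))"
  by (simp_all add: mass_cone_def)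

lemma mult_mass_cone_pos:
  "0 < r \<Longrightarrow> 0 < s \<Longrightarrow> (r, x) \<otimes>\<^bsub>mass_cone\<^esub> (s, y) = (r + s, cc (r / (r + s)) x y)"
  by (simp add: mult_mass_cone)

text \<open>For masses \<open>r\<close>, \<open>s\<close>, \<open>t\<close> the nested coefficients
  \<open>a\<close> and \<open>b\<close> satisfy \<open>a * b = r / (r + (s + t))\<close> and
  \<open>(b - a * b) / (1 - a * b) = s / (s + t)\<close>, which turns \<open>cc_assoc\<close> into
  the claim. Positivity of the masses keeps \<open>a\<close> and \<open>b\<close> below 1, as that
  axiom demands.\<close>

lemma mass_cone_assoc:
  assumes "u \<in> carrier mass_cone" "v \<in> carrier mass_cone" "w \<in> carrier mass_cone"
  shows "u \<otimes>\<^bsub>mass_cone\<^esub> v \<otimes>\<^bsub>mass_cone\<^esub> w = u \<otimes>\<^bsub>mass_cone\<^esub> (v \<otimes>\<^bsub>mass_cone\<^esub> w)"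
proof (cases "fst u = 0 \<or> fst v = 0 \<or> fst w = 0")
  case True
  then show ?thesis using assms by (auto simp: mult_mass_cone carrier_mass_cone)
next
  case False
  then obtain r x s y t z where eq: "u = (r, x)" "v = (s, y)" "w = (t, z)"
    and pos: "0 < r" "0 < s" "0 < t" and A: "x \<in> A" "y \<in> A" "z \<in> A"
    using assms by (auto simp: carrier_mass_cone)
  define a b where "a = r / (r + s)" and "b = (r + s) / (r + s + t)"
  have ab: "a \<in> {0..<1}" "b \<in> {0..<1}" using pos by (auto simp: a_def b_def divide_simps)
  have prod: "a * b = r / (r + (s + t))" using pos by (simp add: a_def b_def add.assoc)
  have "b - a * b = s / (r + (s + t))"
    unfolding prod using pos by (simp add: b_def diff_divide_distrib[symmetric] add.assoc)
  moreover have "1 - a * b = (s + t) / (r + (s + t))"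
    unfolding prod using pos by (simp add: field_simps)
  ultimately have quot: "(b - a * b) / (1 - a * b) = s / (s + t)"
    using pos by simp
  show ?thesis
    using cc_assoc[OF ab A, unfolded quot, unfolded prod] pos unfolding eq
    by (simp add: mult_mass_cone_pos a_def b_def add.assoc)
qed

sublocale mass_cone: Group.comm_monoid mass_cone
proof (rule comm_monoidI)
  show "u \<otimes>\<^bsub>mass_cone\<^esub> v \<in> carrier mass_cone"
    if "u \<in> carrier mass_cone" "v \<in> carrier mass_cone" for u v
    using that closed by (auto simp: carrier_mass_cone mult_mass_cone)
  show "\<one>\<^bsub>mass_cone\<^esub> \<in> carrier mass_cone"
    by (simp add: carrier_mass_cone one_mass_cone)
  show "\<one>\<^bsub>mass_cone\<^esub> \<otimes>\<^bsub>mass_cone\<^esub> u = u" if "u \<in> carrier mass_cone" for u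
    by (simp add: mult_mass_cone one_mass_cone)
  show "u \<otimes>\<^bsub>mass_cone\<^esub> v = v \<otimes>\<^bsub>mass_cone\<^esub> u"
    if uv: "u \<in> carrier mass_cone" "v \<in> carrier mass_cone" for u v
  proof (cases "fst u = 0 \<or> fst v = 0")
    \<comment> \<open>If both are massless, the two products are \<open>v\<close> and
      \<open>u\<close>; they agree because the carrier has only one massless element.\<close>
    case True
    then show ?thesis using uv by (auto simp: mult_mass_cone carrier_mass_cone)
  next
    case False
    then obtain r x s y where eq: "u = (r, x)" "v = (s, y)" and pos: "0 < r" "0 < s"
      and A: "x \<in> A" "y \<in> A"
      using uv by (auto simp: carrier_mass_cone)
    have "1 - r / (r + s) = s / (s + r)" using pos by (simp add: field_simps)
    then show ?thesis
      using cc_commute[of "r / (r + s)" x y] pos A by (simp add: eq mult_mass_cone_pos)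
  qed
qed (fact mass_cone_assoc)

section \<open>Calculus of finite sums of point masses\<close>

lemma weighted_closed [simp]: "0 \<le> r \<Longrightarrow> x \<in> A \<Longrightarrow> weighted r x \<in> carrier mass_cone"
  by (simp add: weighted_def carrier_mass_cone)

lemma weighted_funcset:
  "\<forall>k\<in>I. 0 \<le> w k \<Longrightarrow> f \<in> I \<rightarrow> A \<Longrightarrow> (\<lambda>k. weighted (w k) (f k)) \<in> I \<rightarrow> carrier mass_cone"
  by (simp add: Pi_iff)

lemma fst_weighted [simp]: "fst (weighted r x) = r"
  by (simp add: weighted_def)

lemma weighted_zero: "weighted 0 x = \<one>\<^bsub>mass_cone\<^esub>"
  by (simp add: weighted_def one_mass_cone)

lemma fst_mult_mass_cone: "fst (u \<otimes>\<^bsub>mass_cone\<^esub> v) = fst u + fst v"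
  by (simp add: mult_mass_cone)

text \<open>Idempotence in another guise: splitting the mass at a point does not move its
  centre.\<close>

lemma weighted_add:
  assumes "0 \<le> r" "0 \<le> s" "x \<in> A"
  shows "weighted (r + s) x = weighted r x \<otimes>\<^bsub>mass_cone\<^esub> weighted s x"
  using assms cc_idem[of "r / (r + s)" x] by (auto simp: weighted_def mult_mass_cone)

text \<open>The dictionary back to the algebra: at total mass 1 the addition of the cone is the
  barycentric operation. At the endpoints one summand is massless, which is matched by
  \<open>cc_zero\<close> and \<open>cc_one\<close>.\<close>

lemma weighted_cc:
  assumes "r \<in> {0..1}" "x \<in> A" "y \<in> A"
  shows "weighted r x \<otimes>\<^bsub>mass_cone\<^esub> weighted (1 - r) y = (1, cc r x y)"
  using assms by (auto simp: weighted_def mult_mass_cone cc_zero cc_one)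

text \<open>Going through \<open>weighted\<close> makes the result the one massless element when
  \<open>t = 0\<close>.\<close>

definition scale :: "real \<Rightarrow> real \<times> 'a \<Rightarrow> real \<times> 'a" where
  "scale t u = weighted (t * fst u) (snd u)"

lemma scale_weighted: "scale t (weighted r x) = weighted (t * r) x"
  by (simp add: scale_def weighted_def)

lemma scale_closed: "0 \<le> t \<Longrightarrow> u \<in> carrier mass_cone \<Longrightarrow> scale t u \<in> carrier mass_cone"
  by (auto simp: scale_def weighted_def carrier_mass_cone)

text \<open>A centre of mass depends only on the ratio of the masses, which a common nonzero factor
  leaves unchanged; for \<open>t = 0\<close> both sides are massless.\<close>

lemma scale_mult:
  assumes "0 \<le> t" "u \<in> carrier mass_cone" "v \<in> carrier mass_cone"
  shows "scale t (u \<otimes>\<^bsub>mass_cone\<^esub> v) = scale t u \<otimes>\<^bsub>mass_cone\<^esub> scale t v"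
proof -
  have "t * r / (t * r + t * s) = r / (r + s)" if "t \<noteq> 0" for r s
    using that by (simp add: distrib_left[symmetric])
  then show ?thesis
    using assms by (auto simp: scale_def weighted_def mult_mass_cone carrier_mass_cone distrib_left)
qed

lemma scale_finprod:
  assumes "0 \<le> t" "finite I" "g \<in> I \<rightarrow> carrier mass_cone"
  shows "scale t (finprod mass_cone g I) = finprod mass_cone (\<lambda>k. scale t (g k)) I"
  using assms(2,3)
proof (induction I)
  case empty
  then show ?case by (simp add: scale_def one_mass_cone weighted_def)
next
  case (insert k I)
  then have "g k \<in> carrier mass_cone" "g \<in> I \<rightarrow> carrier mass_cone" by auto
  moreover from this have "(\<lambda>k. scale t (g k)) \<in> I \<rightarrow> carrier mass_cone"
    using assms(1) scale_closed by (simp add: Pi_iff)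
  ultimately show ?case
    using insert assms(1) by (simp add: scale_mult scale_closed)
qed

lemma fst_finprod:
  assumes "finite I" "g \<in> I \<rightarrow> carrier mass_cone"
  shows "fst (finprod mass_cone g I) = (\<Sum>k\<in>I. fst (g k))"
  using assms by (induction I) (auto simp: one_mass_cone fst_mult_mass_cone)

text \<open>A new index \<open>j\<close> changes only the summand at the point \<open>a j\<close>.
  By \<open>weighted_add\<close> the change splits off as a family that is neutral at all other
  points, so its product collapses to a single factor.\<close>

lemma finprod_weighted_group:
  assumes "finite I" "finite S" "\<forall>k\<in>I. 0 \<le> w k" "a \<in> I \<rightarrow> S" "f \<in> S \<rightarrow> A"
  shows "finprod mass_cone (\<lambda>k. weighted (w k) (f (a k))) I
    = finprod mass_cone (\<lambda>x. weighted (\<Sum>k\<in>{k\<in>I. a k = x}. w k) (f x)) S"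
  using assms(1,3,4)
proof (induction I)
  case empty
  have "finprod mass_cone (\<lambda>x. weighted 0 (f x)) S = \<one>\<^bsub>mass_cone\<^esub>"
    by (rule mass_cone.finprod_one_eqI) (simp add: weighted_zero)
  then show ?case by simp
next
  case (insert j I)
  define W where "W x = (\<Sum>k\<in>{k\<in>I. a k = x}. w k)" for x
  have W: "0 \<le> W x" for x
    unfolding W_def using insert.prems by (intro sum_nonneg) auto
  have j: "0 \<le> w j" "a j \<in> S" "f (a j) \<in> A" using insert.prems assms(5) by auto
  have split: "weighted (\<Sum>k\<in>{k\<in>insert j I. a k = x}. w k) (f x)
      = (if a j = x then weighted (w j) (f x) else \<one>\<^bsub>mass_cone\<^esub>) \<otimes>\<^bsub>mass_cone\<^esub> weighted (W x) (f x)"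
    if "x \<in> S" for x
  proof -
    have fx: "f x \<in> A" using that assms(5) by auto
    show ?thesis
    proof (cases "a j = x")
      case True
      then have "{k\<in>insert j I. a k = x} = insert j {k\<in>I. a k = x}" by auto
      then have "(\<Sum>k\<in>{k\<in>insert j I. a k = x}. w k) = w j + W x"
        using insert.hyps by (simp add: W_def)
      then show ?thesis using True weighted_add[OF j(1) W fx] by simp
    next
      case False
      then have "{k\<in>insert j I. a k = x} = {k\<in>I. a k = x}" by auto
      then show ?thesis using False W fx by (simp add: W_def[symmetric])
    qed
  qed
  have P1: "(\<lambda>x. if a j = x then weighted (w j) (f x) else \<one>\<^bsub>mass_cone\<^esub>) \<in> S \<rightarrow> carrier mass_cone"
    using j by auto
  have P2: "(\<lambda>x. weighted (W x) (f x)) \<in> S \<rightarrow> carrier mass_cone"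
    using W assms(5) by (intro weighted_funcset) auto
  have P3: "(\<lambda>x. weighted (w j) (f x)) \<in> S \<rightarrow> carrier mass_cone"
    using j assms(5) by (intro weighted_funcset) auto
  have "finprod mass_cone (\<lambda>x. weighted (\<Sum>k\<in>{k\<in>insert j I. a k = x}. w k) (f x)) S
      = finprod mass_cone (\<lambda>x. (if a j = x then weighted (w j) (f x) else \<one>\<^bsub>mass_cone\<^esub>)
          \<otimes>\<^bsub>mass_cone\<^esub> weighted (W x) (f x)) S"
    using P1 P2 by (intro mass_cone.finprod_cong' split) auto
  also have "\<dots> = weighted (w j) (f (a j)) \<otimes>\<^bsub>mass_cone\<^esub> finprod mass_cone (\<lambda>x. weighted (W x) (f x)) S"
    unfolding mass_cone.finprod_multf[OF P1 P2]
      mass_cone.finprod_singleton[OF j(2) assms(2) P3] ..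
  also have "finprod mass_cone (\<lambda>x. weighted (W x) (f x)) S = finprod mass_cone (\<lambda>k. weighted (w k) (f (a k))) I"
    unfolding W_def using insert by auto
  also have "weighted (w j) (f (a j)) \<otimes>\<^bsub>mass_cone\<^esub> \<dots> = finprod mass_cone (\<lambda>k. weighted (w k) (f (a k))) (insert j I)"
    using insert j assms(5) by (intro mass_cone.finprod_insert[symmetric]) (auto intro!: weighted_closed)
  finally show ?case ..
qed

end

text \<open>Multiplied by the total mass, the estimate becomes additive, so the induction needs no
  renormalised weights. The factor also neutralises a massless sum, whose position is
  \<open>undefined\<close>.\<close>

lemma (in wasserstein_algebra) dist_finprod_weighted:
  assumes "finite I" "\<forall>k\<in>I. 0 \<le> w k" "x \<in> I \<rightarrow> A" "y \<in> I \<rightarrow> A"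
  shows "sum w I * d (snd (finprod mass_cone (\<lambda>k. weighted (w k) (x k)) I))
      (snd (finprod mass_cone (\<lambda>k. weighted (w k) (y k)) I)) powr p
    \<le> (\<Sum>k\<in>I. w k * d (x k) (y k) powr p)"
  using assms
proof (induction I)
  case (insert j I)
  let ?X = "finprod mass_cone (\<lambda>k. weighted (w k) (x k)) I"
  let ?Y = "finprod mass_cone (\<lambda>k. weighted (w k) (y k)) I"
  define W where "W = sum w I"
  have P: "(\<lambda>k. weighted (w k) (x k)) \<in> I \<rightarrow> carrier mass_cone"
    "(\<lambda>k. weighted (w k) (y k)) \<in> I \<rightarrow> carrier mass_cone"
    using insert.prems by (intro weighted_funcset; simp)+
  have j: "0 \<le> w j" "x j \<in> A" "y j \<in> A" using insert.prems by auto
  have W: "0 \<le> W" unfolding W_def using insert.prems by (intro sum_nonneg) auto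
  have IH: "W * d (snd ?X) (snd ?Y) powr p \<le> (\<Sum>k\<in>I. w k * d (x k) (y k) powr p)"
    unfolding W_def using insert by auto
  have XY: "finprod mass_cone (\<lambda>k. weighted (w k) (x k)) (insert j I) = weighted (w j) (x j) \<otimes>\<^bsub>mass_cone\<^esub> ?X"
    "finprod mass_cone (\<lambda>k. weighted (w k) (y k)) (insert j I) = weighted (w j) (y j) \<otimes>\<^bsub>mass_cone\<^esub> ?Y"
    using insert P j by (simp_all add: weighted_closed)
  have mem: "?X \<in> carrier mass_cone" "?Y \<in> carrier mass_cone" using P by simp_all
  have fst: "fst ?X = W" "fst ?Y = W" using P insert.hyps by (simp_all add: fst_finprod W_def)
  consider "w j = 0" | "0 < w j" "W = 0" | "0 < w j" "0 < W" using j(1) W by linarith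
  then show ?case
  proof cases
    case 1
    then show ?thesis using insert.hyps IH mem
      by (simp add: XY weighted_zero W_def[symmetric])
  next
    case 2
    have "0 \<le> (\<Sum>k\<in>I. w k * d (x k) (y k) powr p)"
      using insert.prems by (intro sum_nonneg) auto
    moreover have "weighted (w j) z = (w j, z)" for z using 2 by (simp add: weighted_def)
    ultimately show ?thesis
      using 2 fst insert.hyps by (simp add: XY mult_mass_cone W_def[symmetric])
  next
    case 3
    have A: "snd ?X \<in> A" "snd ?Y \<in> A" using mem fst 3 by (auto simp: carrier_mass_cone)
    \<comment> \<open>The share of the new point in the total mass; multiplying
      \<open>cc_wasserstein\<close> by \<open>w j + W\<close> then clears the denominators.\<close>
    define r where "r = w j / (w j + W)"
    have r: "r \<in> {0..1}" "(w j + W) * r = w j" "(w j + W) * (1 - r) = W"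
      using 3 by (auto simp: r_def field_simps)
    have "(w j + W) * d (cc r (x j) (snd ?X)) (cc r (y j) (snd ?Y)) powr p
        \<le> (w j + W) * (r * d (x j) (y j) powr p + (1 - r) * d (snd ?X) (snd ?Y) powr p)"
      using 3 r(1) j A by (intro mult_left_mono cc_wasserstein) auto
    also have "\<dots> = w j * d (x j) (y j) powr p + W * d (snd ?X) (snd ?Y) powr p"
      by (simp only: distrib_left mult.assoc[symmetric] r(2,3))
    finally have "(w j + W) * d (cc r (x j) (snd ?X)) (cc r (y j) (snd ?Y)) powr p
        \<le> w j * d (x j) (y j) powr p + (\<Sum>k\<in>I. w k * d (x k) (y k) powr p)"
      using IH by linarith
    moreover have "weighted (w j) z = (w j, z)" for z using 3 by (simp add: weighted_def)
    ultimately show ?thesis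
      using insert.hyps 3 fst by (simp add: XY mult_mass_cone W_def[symmetric] r_def[symmetric])
  qed
qed simp

section \<open>Transport plans\<close>

text \<open>For positive arguments this is convexity of the power. If one argument is 0, it reduces
  to \<open>s powr p \<le> s\<close> for \<open>s\<close> in the unit interval.\<close>

lemma powr_convex_nonneg:
  fixes x y t p :: real
  assumes "p \<ge> 1" "0 \<le> x" "0 \<le> y" "t \<in> {0..1}"
  shows "(t * x + (1 - t) * y) powr p \<le> t * x powr p + (1 - t) * y powr p"
proof -
  have aux: "(s * z) powr p \<le> s * z powr p" if "s \<in> {0..1}" "0 \<le> z" for s z
  proof -
    have "s powr p \<le> s"
      using that assms(1) powr_mono'[of 1 p s] by (cases "s = 0") auto
    then show ?thesis
      using that by (simp add: powr_mult mult_right_mono)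
  qed
  consider "x = 0" | "y = 0" | "0 < x" "0 < y" using assms by linarith
  then show ?thesis
  proof cases
    case 1
    then show ?thesis using aux[of "1 - t" y] assms by simp
  next
    case 2
    then show ?thesis using aux[of t x] assms by simp
  next
    case 3
    then show ?thesis
      using convex_onD[OF powr_convex[OF assms(1)], of "1 - t" x y] assms(4) by simp
  qed
qed

text \<open>Summed against a plan, this gives Minkowski's inequality: by convexity of the power,
  \<open>x + y = (\<alpha> + \<beta>) (t (x / \<alpha>) + (1 - t) (y / \<beta>))\<close> with \<open>t = \<alpha> / (\<alpha> + \<beta>)\<close>.\<close>

lemma powr_add_le_scaled:
  fixes x y \<alpha> \<beta> p :: real
  assumes "p \<ge> 1" "0 \<le> x" "0 \<le> y" "0 < \<alpha>" "0 < \<beta>"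
  shows "(x + y) powr p \<le> (\<alpha> + \<beta>) powr p *
    (\<alpha> / (\<alpha> + \<beta>) * (x powr p / \<alpha> powr p) + \<beta> / (\<alpha> + \<beta>) * (y powr p / \<beta> powr p))"
proof -
  define t where "t = \<alpha> / (\<alpha> + \<beta>)"
  have t: "t \<in> {0..1}" "1 - t = \<beta> / (\<alpha> + \<beta>)" using assms by (auto simp: t_def field_simps)
  have "t * (x / \<alpha>) = x / (\<alpha> + \<beta>)" "(1 - t) * (y / \<beta>) = y / (\<alpha> + \<beta>)"
    unfolding t using assms by (auto simp: t_def)
  then have "x + y = (\<alpha> + \<beta>) * (t * (x / \<alpha>) + (1 - t) * (y / \<beta>))"
    using assms by (simp add: add_divide_distrib[symmetric])
  then have "(x + y) powr p = (\<alpha> + \<beta>) powr p * (t * (x / \<alpha>) + (1 - t) * (y / \<beta>)) powr p"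
    using assms t(1) by (simp add: powr_mult)
  also have "\<dots> \<le> (\<alpha> + \<beta>) powr p * (t * (x / \<alpha>) powr p + (1 - t) * (y / \<beta>) powr p)"
    using assms t(1) by (intro mult_left_mono powr_convex_nonneg) auto
  finally show ?thesis
    using assms unfolding t(2) by (simp add: powr_divide t_def)
qed

context Metric_space
begin

text \<open>A coupling given by a finite indexed family of transports from \<open>a k\<close> to \<open>b k\<close>, each moving
  mass \<open>w k\<close>. Pairs may repeat, which spares merging them in constructions.\<close>

definition plan :: "'k set \<Rightarrow> ('k \<Rightarrow> real) \<Rightarrow> ('k \<Rightarrow> 'a) \<Rightarrow> ('k \<Rightarrow> 'a) \<Rightarrow> 'a measure \<Rightarrow> 'a measure \<Rightarrow> bool"
  where "plan I w a b \<mu> \<nu> \<longleftrightarrow> finite I \<and> (\<forall>k\<in>I. 0 \<le> w k) \<and> a \<in> I \<rightarrow> M \<and> b \<in> I \<rightarrow> M \<and>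
    (\<forall>x\<in>M. (\<Sum>k\<in>{k\<in>I. a k = x}. w k) = measure \<mu> {x}) \<and>
    (\<forall>x\<in>M. (\<Sum>k\<in>{k\<in>I. b k = x}. w k) = measure \<nu> {x})"

lemma sum_plan:
  assumes "plan I w a b \<mu> \<nu>" "\<mu> \<in> fin_prob M d"
  shows "sum w I = 1"
proof -
  \<comment> \<open>Grouping needs all starting points in the carrier, \<open>sum_masses\<close> all
    atoms.\<close>
  let ?S = "mass_support \<mu> \<union> a ` I"
  have S: "finite ?S" "?S \<subseteq> M"
    using assms finite_mass_support mass_support_subset by (auto simp: plan_def)
  have "sum w I = (\<Sum>x\<in>?S. \<Sum>k\<in>{k\<in>I. a k = x}. w k)"
    using assms S by (intro sum.group[symmetric]) (auto simp: plan_def)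
  also have "\<dots> = (\<Sum>x\<in>?S. measure \<mu> {x})"
    using assms S by (intro sum.cong) (auto simp: plan_def)
  finally show ?thesis using sum_masses[OF assms(2) S(1) _ S(2)] by simp
qed

lemma weighted_measure_plan:
  assumes "plan I w a b \<mu> \<nu>" "\<mu> \<in> fin_prob M d" "\<nu> \<in> fin_prob M d"
  shows "weighted_measure I w a (mborel M d) = \<mu>" "weighted_measure I w b (mborel M d) = \<nu>"
  using assms sum_plan[OF assms(1,2)]
  by (auto intro!: fin_prob_eqI weighted_measure_fin_prob simp: measure_weighted_singleton plan_def)

section \<open>From couplings to finite plans and back\<close>

lemma wasserstein_powr:
  assumes "p > 0"
  shows "wasserstein p M d \<mu> \<nu> powr p =
    enn2real (INF \<gamma>\<in>couplings M d \<mu> \<nu>. \<integral>\<^sup>+ z. ennreal (d (fst z) (snd z) powr p) \<partial>\<gamma>)"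
  using assms by (simp add: wasserstein_def powr_powr)

lemma borel_measurable_dist_powr:
  "(\<lambda>z. d (fst z) (snd z) powr p) \<in> borel_measurable (borel_of (prod_topology mtopology mtopology))"
  using borel_measurable_dist by measurable

text \<open>Stated in the extended reals, because it also serves to show that the infimum is finite;
  at infinity \<open>enn2real\<close> would return 0.\<close>

lemma INF_couplings_le_plan:
  assumes "plan I w a b \<mu> \<nu>" "\<mu> \<in> fin_prob M d" "\<nu> \<in> fin_prob M d"
  shows "(INF \<gamma>\<in>couplings M d \<mu> \<nu>. \<integral>\<^sup>+ z. ennreal (d (fst z) (snd z) powr p) \<partial>\<gamma>)
    \<le> ennreal (\<Sum>k\<in>I. w k * d (a k) (b k) powr p)"
proof -
  define P where "P = borel_of (prod_topology mtopology mtopology)"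
  define \<gamma> where "\<gamma> = weighted_measure I w (\<lambda>k. (a k, b k)) P"
  have I: "finite I" "\<forall>k\<in>I. 0 \<le> w k" "(\<lambda>k. (a k, b k)) \<in> I \<rightarrow> space P"
    using assms(1) by (auto simp: plan_def P_def space_mborel_prod)
  have "\<gamma> \<in> couplings M d \<mu> \<nu>"
    unfolding couplings_def
  proof (intro CollectI conjI)
    show "prob_space \<gamma>"
      unfolding \<gamma>_def using I sum_plan[OF assms(1,2)] by (intro prob_space_weighted_measure)
    show "sets \<gamma> = sets (borel_of (prod_topology mtopology mtopology))"
      by (simp add: \<gamma>_def P_def)
    show "distr \<gamma> (mborel M d) fst = \<mu>" "distr \<gamma> (mborel M d) snd = \<nu>"
      using weighted_measure_plan[OF assms] I(3) measurable_fst_mborel measurable_snd_mborel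
      by (simp_all add: \<gamma>_def P_def distr_weighted_measure)
  qed
  moreover have "(\<integral>\<^sup>+ z. ennreal (d (fst z) (snd z) powr p) \<partial>\<gamma>) = ennreal (\<Sum>k\<in>I. w k * d (a k) (b k) powr p)"
    unfolding \<gamma>_def using I borel_measurable_dist_powr
    by (subst nn_integral_weighted_measure) (auto simp: P_def)
  ultimately show ?thesis by (intro INF_lower2[of \<gamma>]) simp_all
qed

lemma plan_wasserstein:
  assumes "p > 0" "plan I w a b \<mu> \<nu>" "\<mu> \<in> fin_prob M d" "\<nu> \<in> fin_prob M d"
  shows "wasserstein p M d \<mu> \<nu> powr p \<le> (\<Sum>k\<in>I. w k * d (a k) (b k) powr p)"
proof -
  have "0 \<le> (\<Sum>k\<in>I. w k * d (a k) (b k) powr p)"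
    using assms(2) by (intro sum_nonneg) (auto simp: plan_def)
  then show ?thesis
    unfolding wasserstein_powr[OF assms(1)]
    using INF_couplings_le_plan[OF assms(2-4), of p] by (rule enn2real_leI)
qed

text \<open>The marginals give \<open>S\<close> and \<open>T\<close> full mass; pulled back along
  the projections, this puts almost every point of the coupling in \<open>S \<times> T\<close>, a
  finite set whose subsets are Borel. Marginals and cost then become sums of point masses. The
  carriers are free so that several plans can share an index set.\<close>

lemma coupling_plan:
  assumes \<gamma>: "\<gamma> \<in> couplings M d \<mu> \<nu>" and fin: "\<mu> \<in> fin_prob M d" "\<nu> \<in> fin_prob M d"
    and S: "finite S" "mass_support \<mu> \<subseteq> S" "S \<subseteq> M"
    and T: "finite T" "mass_support \<nu> \<subseteq> T" "T \<subseteq> M"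
  shows "plan (S \<times> T) (\<lambda>z. measure \<gamma> {z}) fst snd \<mu> \<nu>"
    and "(\<integral>\<^sup>+ z. ennreal (d (fst z) (snd z) powr p) \<partial>\<gamma>)
      = ennreal (\<Sum>z\<in>S \<times> T. measure \<gamma> {z} * d (fst z) (snd z) powr p)"
proof -
  interpret prob_space \<gamma> using \<gamma> by (simp add: couplings_def)
  have sets_\<gamma>: "sets \<gamma> = sets (borel_of (prod_topology mtopology mtopology))"
    and distr: "distr \<gamma> (mborel M d) fst = \<mu>" "distr \<gamma> (mborel M d) snd = \<nu>"
    using \<gamma> by (auto simp: couplings_def)
  have meas: "fst \<in> \<gamma> \<rightarrow>\<^sub>M mborel M d" "snd \<in> \<gamma> \<rightarrow>\<^sub>M mborel M d"
    using measurable_fst_mborel measurable_snd_mborel by (simp_all cong: measurable_cong_sets add: sets_\<gamma>)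
  have ev: "F \<in> events" if "F \<subseteq> S \<times> T" for F
    unfolding sets_\<gamma> using that S T by (intro finite_sets_mborel_prod finite_subset[of F "S \<times> T"]) auto
  have AE_support: "AE x in \<rho>. x \<in> R"
    if "\<rho> \<in> fin_prob M d" "finite R" "mass_support \<rho> \<subseteq> R" "R \<subseteq> M" for \<rho> R
  proof -
    interpret \<rho>: prob_space \<rho> using that(1) by (rule fin_probD)
    have "R \<in> sets (mborel M d)" using that by (simp add: finite_sets_mborel)
    then show ?thesis
      using measure_fin_prob[OF that, of R] sum_masses[OF that] that
      by (intro \<rho>.AE_prob_1) simp
  qed
  have "AE z in \<gamma>. fst z \<in> S"
    using AE_support[OF fin(1) S] distr(1) meas(1) by (intro AE_distrD[of fst \<gamma> "mborel M d"]) auto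
  moreover have "AE z in \<gamma>. snd z \<in> T"
    using AE_support[OF fin(2) T] distr(2) meas(2) by (intro AE_distrD[of snd \<gamma> "mborel M d"]) auto
  ultimately have AE: "AE z in \<gamma>. z \<in> S \<times> T"
    by eventually_elim (auto simp: mem_Times_iff)
  have marginal: "(\<Sum>z\<in>{z\<in>S \<times> T. h z = x}. prob {z}) = measure \<rho> {x}"
    if "x \<in> M" "h \<in> \<gamma> \<rightarrow>\<^sub>M mborel M d" "distr \<gamma> (mborel M d) h = \<rho>" for h x and \<rho> :: "'a measure"
  proof -
    have x: "{x} \<in> sets (mborel M d)" using that by (simp add: finite_sets_mborel)
    have "measure \<rho> {x} = prob (h -` {x} \<inter> space \<gamma>)"
      using that x by (auto simp: measure_distr)
    also have "\<dots> = prob {z\<in>S \<times> T. h z = x}"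
    proof (rule measure_eq_AE)
      show "AE z in \<gamma>. (z \<in> h -` {x} \<inter> space \<gamma>) = (z \<in> {z\<in>S \<times> T. h z = x})"
        using AE AE_space by eventually_elim auto
      show "h -` {x} \<inter> space \<gamma> \<in> events" using that x by (intro measurable_sets)
      show "{z\<in>S \<times> T. h z = x} \<in> events" by (rule ev) auto
    qed
    also have "\<dots> = (\<Sum>z\<in>{z\<in>S \<times> T. h z = x}. prob {z})"
      using S T ev by (intro finite_measure_eq_sum_singleton) auto
    finally show ?thesis ..
  qed
  show "plan (S \<times> T) (\<lambda>z. prob {z}) fst snd \<mu> \<nu>"
    unfolding plan_def using S T marginal meas distr by auto
  show "(\<integral>\<^sup>+ z. ennreal (d (fst z) (snd z) powr p) \<partial>\<gamma>)
      = ennreal (\<Sum>z\<in>S \<times> T. prob {z} * d (fst z) (snd z) powr p)"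
    using S T ev AE by (intro nn_integral_finite_support) auto
qed

text \<open>The independent coupling. It is a plan of finite cost, which makes the infimum
  finite.\<close>

lemma product_plan:
  assumes fin: "\<mu> \<in> fin_prob M d" "\<nu> \<in> fin_prob M d"
  shows "plan (mass_support \<mu> \<times> mass_support \<nu>) (\<lambda>z. measure \<mu> {fst z} * measure \<nu> {snd z}) fst snd \<mu> \<nu>"
proof -
  let ?S = "mass_support \<mu>" and ?T = "mass_support \<nu>"
  have sums: "(\<Sum>x\<in>?S. measure \<mu> {x}) = 1" "(\<Sum>x\<in>?T. measure \<nu> {x}) = 1"
    using sum_masses[OF fin(1)] sum_masses[OF fin(2)] finite_mass_support fin mass_support_subset by auto
  have "(\<Sum>z\<in>{z\<in>?S \<times> ?T. fst z = x}. measure \<mu> {fst z} * measure \<nu> {snd z}) = measure \<mu> {x}"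
    if "x \<in> M" for x
  proof (cases "x \<in> ?S")
    case True
    then have "{z\<in>?S \<times> ?T. fst z = x} = {x} \<times> ?T" by auto
    then show ?thesis
      by (simp add: sum.cartesian_product' sums sum_distrib_left[symmetric])
  next
    case False
    then have "{z\<in>?S \<times> ?T. fst z = x} = {}" by auto
    with False show ?thesis
      using that by (simp only: sum.empty) (simp add: mass_support_def)
  qed
  moreover have "(\<Sum>z\<in>{z\<in>?S \<times> ?T. snd z = x}. measure \<mu> {fst z} * measure \<nu> {snd z}) = measure \<nu> {x}"
    if "x \<in> M" for x
  proof (cases "x \<in> ?T")
    case True
    then have "{z\<in>?S \<times> ?T. snd z = x} = ?S \<times> {x}" by auto
    then show ?thesis
      by (simp add: sum.cartesian_product' sums sum_distrib_right[symmetric])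
  next
    case False
    then have "{z\<in>?S \<times> ?T. snd z = x} = {}" by auto
    with False show ?thesis
      using that by (simp only: sum.empty) (simp add: mass_support_def)
  qed
  ultimately show ?thesis
    unfolding plan_def using finite_mass_support fin mass_support_subset by (auto simp: subset_iff)
qed

text \<open>A strict bound on an infimum is met by some coupling, hence by a plan. Passing from
  \<open>enn2real V < c\<close> to \<open>V < ennreal c\<close> requires \<open>V\<close> to be
  finite, which the product plan provides.\<close>

lemma wasserstein_plan:
  assumes "p > 0" and fin: "\<mu> \<in> fin_prob M d" "\<nu> \<in> fin_prob M d"
    and S: "finite S" "mass_support \<mu> \<subseteq> S" "S \<subseteq> M"
    and T: "finite T" "mass_support \<nu> \<subseteq> T" "T \<subseteq> M"
    and less: "wasserstein p M d \<mu> \<nu> powr p < c"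
  shows "\<exists>w. plan (S \<times> T) w fst snd \<mu> \<nu> \<and> (\<Sum>z\<in>S \<times> T. w z * d (fst z) (snd z) powr p) < c"
proof -
  define V where "V = (INF \<gamma>\<in>couplings M d \<mu> \<nu>. \<integral>\<^sup>+ z. ennreal (d (fst z) (snd z) powr p) \<partial>\<gamma>)"
  have "V < top_class.top"
    using INF_couplings_le_plan[OF product_plan[OF fin] fin, of p] ennreal_less_top
    unfolding V_def by (rule le_less_trans)
  moreover have "enn2real V < c" using less unfolding wasserstein_powr[OF assms(1)] V_def .
  ultimately have "V < ennreal c"
    using enn2real_nonneg[of V] by (cases V) (simp_all add: ennreal_less_iff)
  then obtain \<gamma> where \<gamma>: "\<gamma> \<in> couplings M d \<mu> \<nu>"
    and cost: "(\<integral>\<^sup>+ z. ennreal (d (fst z) (snd z) powr p) \<partial>\<gamma>) < ennreal c"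
    unfolding V_def by (auto simp: INF_less_iff)
  have "(\<Sum>z\<in>S \<times> T. measure \<gamma> {z} * d (fst z) (snd z) powr p) < c"
    using cost unfolding coupling_plan(2)[OF \<gamma> fin S T]
    by (subst (asm) ennreal_less_iff) (auto intro: sum_nonneg)
  then show ?thesis
    using coupling_plan(1)[OF \<gamma> fin S T] by blast
qed

lemma wasserstein_support_plan:
  assumes "p > 0" "\<mu> \<in> fin_prob M d" "\<nu> \<in> fin_prob M d" "wasserstein p M d \<mu> \<nu> powr p < c"
  shows "\<exists>w. plan (mass_support \<mu> \<times> mass_support \<nu>) w fst snd \<mu> \<nu> \<and>
    (\<Sum>z\<in>mass_support \<mu> \<times> mass_support \<nu>. w z * d (fst z) (snd z) powr p) < c"
  using assms by (intro wasserstein_plan finite_mass_support mass_support_subset order_refl)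

text \<open>Symmetry is required of arbitrary measures, not only of finitely supported ones, so plans
  do not suffice here.\<close>

lemma INF_couplings_swap_le:
  "(INF \<gamma>\<in>couplings M d \<nu> \<mu>. \<integral>\<^sup>+ z. ennreal (d (fst z) (snd z) powr p) \<partial>\<gamma>)
    \<le> (INF \<gamma>\<in>couplings M d \<mu> \<nu>. \<integral>\<^sup>+ z. ennreal (d (fst z) (snd z) powr p) \<partial>\<gamma>)"
proof (rule INF_greatest)
  fix \<gamma> assume \<gamma>: "\<gamma> \<in> couplings M d \<mu> \<nu>"
  define P where "P = borel_of (prod_topology mtopology mtopology)"
  interpret prob_space \<gamma> using \<gamma> by (simp add: couplings_def)
  have sets_\<gamma> [measurable_cong]: "sets \<gamma> = sets P"
    using \<gamma> by (auto simp: couplings_def P_def)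
  have swap: "prod.swap \<in> \<gamma> \<rightarrow>\<^sub>M P"
    using measurable_swap_mborel by (simp cong: measurable_cong_sets add: sets_\<gamma> P_def)
  have "distr \<gamma> P prod.swap \<in> couplings M d \<nu> \<mu>"
    using \<gamma> swap measurable_fst_mborel measurable_snd_mborel prob_space_distr[OF swap]
    by (auto simp: couplings_def distr_distr comp_def P_def)
  moreover have "(\<integral>\<^sup>+ z. ennreal (d (fst z) (snd z) powr p) \<partial>distr \<gamma> P prod.swap)
      = (\<integral>\<^sup>+ z. ennreal (d (fst z) (snd z) powr p) \<partial>\<gamma>)"
    using swap borel_measurable_dist_powr by (subst nn_integral_distr) (auto simp: P_def commute)
  ultimately show "(INF \<gamma>\<in>couplings M d \<nu> \<mu>. \<integral>\<^sup>+ z. ennreal (d (fst z) (snd z) powr p) \<partial>\<gamma>)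
      \<le> (\<integral>\<^sup>+ z. ennreal (d (fst z) (snd z) powr p) \<partial>\<gamma>)"
    by (intro INF_lower2[of "distr \<gamma> P prod.swap"]) simp_all
qed

lemma wasserstein_commute: "wasserstein p M d \<mu> \<nu> = wasserstein p M d \<nu> \<mu>"
  unfolding wasserstein_def
  using INF_couplings_swap_le[of p \<mu> \<nu>] INF_couplings_swap_le[of p \<nu> \<mu>] by (simp add: antisym)

section \<open>Nonnegativity and separation\<close>

lemma wasserstein_nonneg: "0 \<le> wasserstein p M d \<mu> \<nu>"
  by (simp add: wasserstein_def)

lemma wasserstein_self:
  assumes "p > 0" "\<mu> \<in> fin_prob M d"
  shows "wasserstein p M d \<mu> \<mu> = 0"
proof -
  have "(\<Sum>k\<in>{k\<in>mass_support \<mu>. k = x}. measure \<mu> {k}) = measure \<mu> {x}" if "x \<in> M" for x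
  proof (cases "x \<in> mass_support \<mu>")
    case True
    then have "{k\<in>mass_support \<mu>. k = x} = {x}" by auto
    then show ?thesis by simp
  next
    case False
    then have "{k\<in>mass_support \<mu>. k = x} = {}" by auto
    with False that show ?thesis by (simp only: sum.empty) (simp add: mass_support_def)
  qed
  \<comment> \<open>The diagonal plan, which leaves every atom in place.\<close>
  then have plan: "plan (mass_support \<mu>) (\<lambda>x. measure \<mu> {x}) (\<lambda>x. x) (\<lambda>x. x) \<mu> \<mu>"
    using finite_mass_support[OF assms(2)] mass_support_subset by (auto simp: plan_def)
  have "(\<Sum>x\<in>mass_support \<mu>. measure \<mu> {x} * d x x powr p) = 0"
    by (intro sum.neutral) (auto simp: mass_support_def)
  then have "wasserstein p M d \<mu> \<mu> powr p \<le> 0"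
    using plan_wasserstein[OF assms(1) plan assms(2) assms(2)] by simp
  then have "wasserstein p M d \<mu> \<mu> powr p = 0"
    by (simp add: order_antisym)
  then show ?thesis by simp
qed

text \<open>The mass at \<open>x\<close> changes only through transports with
  \<open>a k \<noteq> b k\<close>, so the discrepancy is at most the mass that moves, and each unit
  of it costs at least \<open>e powr p\<close>.\<close>

lemma plan_cost_ge_mass_difference:
  assumes plan: "plan I w a b \<mu> \<nu>" and x: "x \<in> M" and p: "p > 0"
    and e: "0 \<le> e" "\<And>k. \<lbrakk>k \<in> I; a k \<noteq> b k\<rbrakk> \<Longrightarrow> e \<le> d (a k) (b k)"
  shows "e powr p * \<bar>measure \<mu> {x} - measure \<nu> {x}\<bar> \<le> (\<Sum>k\<in>I. w k * d (a k) (b k) powr p)"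
proof -
  have w: "finite I" "\<And>k. k \<in> I \<Longrightarrow> 0 \<le> w k" using plan by (auto simp: plan_def)
  have "measure \<mu> {x} - measure \<nu> {x}
      = (\<Sum>k\<in>I. (if a k = x then w k else 0) - (if b k = x then w k else 0))"
    using plan x by (simp add: plan_def sum_subtractf sum.inter_filter[symmetric])
  also have "\<bar>\<dots>\<bar> \<le> (\<Sum>k\<in>I. if a k = b k then 0 else w k)"
    using w by (intro order_trans[OF sum_abs] sum_mono) auto
  finally have "e powr p * \<bar>measure \<mu> {x} - measure \<nu> {x}\<bar>
      \<le> e powr p * (\<Sum>k\<in>I. if a k = b k then 0 else w k)"
    by (rule mult_left_mono) simp
  also have "\<dots> \<le> (\<Sum>k\<in>I. w k * d (a k) (b k) powr p)"
    unfolding sum_distrib_left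
  proof (rule sum_mono)
    fix k assume k: "k \<in> I"
    show "e powr p * (if a k = b k then 0 else w k) \<le> w k * d (a k) (b k) powr p"
    proof (cases "a k = b k")
      case False
      then have "e powr p \<le> d (a k) (b k) powr p"
        using e k p by (intro powr_mono2) auto
      then show ?thesis using False w k by (simp add: mult.commute[of _ "w k"] mult_left_mono)
    qed (use w k in simp)
  qed
  finally show ?thesis .
qed

text \<open>Distance 0 only yields plans of arbitrarily small cost. If the masses differed at some
  point, the least positive distance between atoms of the two measures would bound all these costs
  below by one positive constant.\<close>

lemma wasserstein_eq_0:
  assumes "p > 0" and fin: "\<mu> \<in> fin_prob M d" "\<nu> \<in> fin_prob M d"
    and zero: "wasserstein p M d \<mu> \<nu> = 0"
  shows "\<mu> = \<nu>"
proof (rule fin_prob_eqI[OF fin], rule ccontr)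
  fix x assume x: "x \<in> M" and neq: "measure \<mu> {x} \<noteq> measure \<nu> {x}"
  let ?F = "mass_support \<mu> \<times> mass_support \<nu>"
  have F: "finite ?F" using fin finite_mass_support by auto
  \<comment> \<open>The 1 keeps \<open>D\<close> nonempty when no two distinct atoms face each
    other; any positive number would do.\<close>
  define D where "D = insert 1 ((\<lambda>z. d (fst z) (snd z)) ` {z \<in> ?F. fst z \<noteq> snd z})"
  have D: "finite D" "D \<noteq> {}" using F by (auto simp: D_def)
  have "0 < y" if "y \<in> D" for y
    using that mass_support_subset nonneg by (auto simp: D_def less_le subset_iff)
  then have pos: "0 < Min D" using D by simp
  have le: "Min D \<le> d (fst z) (snd z)" if "z \<in> ?F" "fst z \<noteq> snd z" for z
    using D that by (intro Min_le) (auto simp: D_def)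
  let ?c = "Min D powr p * \<bar>measure \<mu> {x} - measure \<nu> {x}\<bar>"
  have "wasserstein p M d \<mu> \<nu> powr p < ?c"
    using pos neq zero by simp
  then obtain w where plan: "plan ?F w fst snd \<mu> \<nu>"
    and cost: "(\<Sum>z\<in>?F. w z * d (fst z) (snd z) powr p) < ?c"
    using wasserstein_support_plan[OF assms(1) fin] by blast
  have "?c \<le> (\<Sum>z\<in>?F. w z * d (fst z) (snd z) powr p)"
    using plan x assms(1) less_imp_le[OF pos] le by (rule plan_cost_ge_mass_difference)
  then show False using cost by simp
qed

text \<open>Gluing along the common marginal \<open>m\<close>: the second factor is used with its conditional weights
  \<open>v l / m (b k)\<close>. Division by zero is harmless because \<open>w k\<close> vanishes there.\<close>

lemma sum_glue:
  fixes w :: "'k \<Rightarrow> real" and v :: "'l \<Rightarrow> real" and m :: "'c \<Rightarrow> real"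
  assumes "finite J" and v: "\<And>k. k \<in> I \<Longrightarrow> (\<Sum>l\<in>{l\<in>J. a' l = b k}. v l) = m (b k)"
    and "\<And>k. \<lbrakk>k \<in> I; m (b k) = 0\<rbrakk> \<Longrightarrow> w k = 0"
  shows "(\<Sum>k\<in>I. \<Sum>l\<in>J. (if b k = a' l then w k * v l / m (b k) else 0) * g k) = (\<Sum>k\<in>I. w k * g k)"
proof (rule sum.cong[OF refl])
  fix k assume k: "k \<in> I"
  have "(\<Sum>l\<in>J. (if b k = a' l then w k * v l / m (b k) else 0) * g k)
      = (\<Sum>l\<in>J. w k / m (b k) * g k * (if a' l = b k then v l else 0))"
    by (intro sum.cong) auto
  also have "\<dots> = w k / m (b k) * g k * m (b k)"
    unfolding sum_distrib_left[symmetric] sum.inter_filter[OF assms(1), symmetric] v[OF k] ..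
  finally show "(\<Sum>l\<in>J. (if b k = a' l then w k * v l / m (b k) else 0) * g k) = w k * g k"
    using assms(3)[OF k] by auto
qed

text \<open>Nonnegative weights over a point of mass 0 sum to 0, so each vanishes. This supplies the
  vanishing condition of \<open>sum_glue\<close>.\<close>

lemma plan_zero_weight:
  assumes "plan I w a b \<mu> \<nu>" "k \<in> I"
  shows "measure \<mu> {a k} = 0 \<Longrightarrow> w k = 0" "measure \<nu> {b k} = 0 \<Longrightarrow> w k = 0"
proof -
  have I: "finite I" "\<And>k. k \<in> I \<Longrightarrow> 0 \<le> w k" using assms by (auto simp: plan_def)
  have zero: "w k = 0" if "(\<Sum>k'\<in>{k'\<in>I. h k' = h k}. w k') = 0" for h :: "_ \<Rightarrow> 'a"
    using that I assms(2) sum_nonneg_eq_0_iff[of "{k'\<in>I. h k' = h k}" w] by simp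
  have "a k \<in> M" "b k \<in> M" using assms by (auto simp: plan_def)
  then have "(\<Sum>k'\<in>{k'\<in>I. a k' = a k}. w k') = measure \<mu> {a k}"
    "(\<Sum>k'\<in>{k'\<in>I. b k' = b k}. w k') = measure \<nu> {b k}"
    using assms by (simp_all add: plan_def)
  then show "measure \<mu> {a k} = 0 \<Longrightarrow> w k = 0" "measure \<nu> {b k} = 0 \<Longrightarrow> w k = 0"
    using zero[of a] zero[of b] by simp_all
qed

text \<open>The two summation identities say that \<open>u\<close> projects to \<open>w\<close> on
  \<open>I\<close> and to \<open>v\<close> on \<open>J\<close>, tested against arbitrary functions.
  Indicator functions give the marginals of the glued plan; the two costs are the test functions for
  the triangle inequality.\<close>

lemma plan_glue:
  assumes P: "plan I w a b \<mu> \<nu>" and Q: "plan J v a' b' \<nu> \<rho>"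
  defines "u \<equiv> \<lambda>z. if b (fst z) = a' (snd z) then w (fst z) * v (snd z) / measure \<nu> {b (fst z)} else 0"
  shows "plan (I \<times> J) u (a \<circ> fst) (b' \<circ> snd) \<mu> \<rho>"
    and "(\<Sum>z\<in>I \<times> J. u z * g (fst z)) = (\<Sum>k\<in>I. w k * g k)"
    and "(\<Sum>z\<in>I \<times> J. u z * h (snd z)) = (\<Sum>l\<in>J. v l * h l)"
proof -
  have fin: "finite I" "finite J" using P Q by (auto simp: plan_def)
  have sum1: "(\<Sum>z\<in>I \<times> J. u z * g (fst z)) = (\<Sum>k\<in>I. w k * g k)" for g
    unfolding u_def sum.cartesian_product' fst_conv snd_conv
    using fin Q P plan_zero_weight(2)[OF P] by (intro sum_glue) (auto simp: plan_def)
  have sum2: "(\<Sum>z\<in>I \<times> J. u z * h (snd z)) = (\<Sum>l\<in>J. v l * h l)" for h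
  proof -
    have "(\<Sum>z\<in>I \<times> J. u z * h (snd z)) = (\<Sum>l\<in>J. \<Sum>k\<in>I. u (k, l) * h l)"
      unfolding sum.cartesian_product' fst_conv snd_conv by (rule sum.swap)
    \<comment> \<open>Where the condition holds, \<open>b k = a' l\<close>, so the denominator may
      be read at \<open>a' l\<close> and \<open>sum_glue\<close> applies with the two plans
      exchanged.\<close>
    also have "\<dots> = (\<Sum>l\<in>J. \<Sum>k\<in>I. (if a' l = b k then v l * w k / measure \<nu> {a' l} else 0) * h l)"
      by (intro sum.cong) (auto simp: u_def mult.commute)
    also have "\<dots> = (\<Sum>l\<in>J. v l * h l)"
      using fin Q P plan_zero_weight(1)[OF Q] by (intro sum_glue) (auto simp: plan_def)
    finally show ?thesis .
  qed
  show "(\<Sum>z\<in>I \<times> J. u z * g (fst z)) = (\<Sum>k\<in>I. w k * g k)"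
    "(\<Sum>z\<in>I \<times> J. u z * h (snd z)) = (\<Sum>l\<in>J. v l * h l)" by (rule sum1 sum2)+
  have filter: "sum q {z\<in>K. R z} = (\<Sum>z\<in>K. q z * (if R z then 1 else 0))"
    if "finite K" for K R and q :: "_ \<Rightarrow> real"
    using that by (auto simp: sum.inter_filter intro!: sum.cong)
  have "(\<Sum>z\<in>{z\<in>I \<times> J. (a \<circ> fst) z = x}. u z) = (\<Sum>k\<in>{k\<in>I. a k = x}. w k)" for x
    using sum1[of "\<lambda>k. if a k = x then 1 else 0"] fin by (simp add: filter finite_cartesian_product)
  moreover have "(\<Sum>z\<in>{z\<in>I \<times> J. (b' \<circ> snd) z = x}. u z) = (\<Sum>l\<in>{l\<in>J. b' l = x}. v l)" for x
    using sum2[of "\<lambda>l. if b' l = x then 1 else 0"] fin by (simp add: filter finite_cartesian_product)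
  ultimately show "plan (I \<times> J) u (a \<circ> fst) (b' \<circ> snd) \<mu> \<rho>"
    using P Q unfolding plan_def by (auto simp: u_def)
qed

text \<open>Minkowski's inequality on the glued plan. Positive bounds \<alpha> and \<beta> stand in
  for the two distances, which may be 0 and could not be divided by.\<close>

lemma plan_triangle:
  assumes p: "p \<ge> 1" and P: "plan I w a b \<mu> \<nu>" and Q: "plan J v a' b' \<nu> \<rho>"
    and fin: "\<mu> \<in> fin_prob M d" "\<rho> \<in> fin_prob M d"
    and pos: "0 < \<alpha>" "0 < \<beta>"
    and cost: "(\<Sum>k\<in>I. w k * d (a k) (b k) powr p) \<le> \<alpha> powr p"
      "(\<Sum>l\<in>J. v l * d (a' l) (b' l) powr p) \<le> \<beta> powr p"
  shows "wasserstein p M d \<mu> \<rho> powr p \<le> (\<alpha> + \<beta>) powr p"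
proof -
  define u where "u = (\<lambda>z. if b (fst z) = a' (snd z)
    then w (fst z) * v (snd z) / measure \<nu> {b (fst z)} else 0)"
  have glue: "plan (I \<times> J) u (a \<circ> fst) (b' \<circ> snd) \<mu> \<rho>"
    "(\<Sum>z\<in>I \<times> J. u z * g (fst z)) = (\<Sum>k\<in>I. w k * g k)"
    "(\<Sum>z\<in>I \<times> J. u z * h (snd z)) = (\<Sum>l\<in>J. v l * h l)" for g h
    unfolding u_def by (rule plan_glue[OF P Q])+
  \<comment> \<open>The coefficients of the two powers in \<open>powr_add_le_scaled\<close>; they
    satisfy \<open>A * \<alpha> powr p + B * \<beta> powr p = (\<alpha> + \<beta>) powr
    p\<close>.\<close>
  define A where "A = (\<alpha> + \<beta>) powr p * (\<alpha> / (\<alpha> + \<beta>)) / \<alpha> powr p"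
  define B where "B = (\<alpha> + \<beta>) powr p * (\<beta> / (\<alpha> + \<beta>)) / \<beta> powr p"
  have AB: "0 \<le> A" "0 \<le> B" "A * \<alpha> powr p + B * \<beta> powr p = (\<alpha> + \<beta>) powr p"
  proof -
    have "A * \<alpha> powr p + B * \<beta> powr p = (\<alpha> + \<beta>) powr p * (\<alpha> / (\<alpha> + \<beta>) + \<beta> / (\<alpha> + \<beta>))"
      using pos by (simp add: A_def B_def distrib_left)
    also have "\<alpha> / (\<alpha> + \<beta>) + \<beta> / (\<alpha> + \<beta>) = 1"
      using pos by (simp add: add_divide_distrib[symmetric])
    finally show "A * \<alpha> powr p + B * \<beta> powr p = (\<alpha> + \<beta>) powr p" by simp
  qed (use pos in \<open>simp_all add: A_def B_def\<close>)
  have "wasserstein p M d \<mu> \<rho> powr p \<le> (\<Sum>z\<in>I \<times> J. u z * d ((a \<circ> fst) z) ((b' \<circ> snd) z) powr p)"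
    using p by (intro plan_wasserstein glue fin) auto
  also have "\<dots> \<le> (\<Sum>z\<in>I \<times> J. u z * (A * d (a (fst z)) (b (fst z)) powr p + B * d (a' (snd z)) (b' (snd z)) powr p))"
  proof (rule sum_mono)
    fix z assume z: "z \<in> I \<times> J"
    obtain k l where kl: "z = (k, l)" "k \<in> I" "l \<in> J" using z by auto
    have u: "0 \<le> u z" using z glue(1) by (auto simp: plan_def)
    show "u z * d ((a \<circ> fst) z) ((b' \<circ> snd) z) powr p
        \<le> u z * (A * d (a (fst z)) (b (fst z)) powr p + B * d (a' (snd z)) (b' (snd z)) powr p)"
    proof (cases "b k = a' l")
      case True
      have "a k \<in> M" "b k \<in> M" "b' l \<in> M"
        using P Q kl by (auto simp: plan_def)
      then have "d (a k) (b' l) \<le> d (a k) (b k) + d (a' l) (b' l)"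
        using triangle[of "a k" "b k" "b' l"] by (simp add: True)
      then have "d (a k) (b' l) powr p \<le> (d (a k) (b k) + d (a' l) (b' l)) powr p"
        using p by (intro powr_mono2) auto
      also have "\<dots> \<le> A * d (a k) (b k) powr p + B * d (a' l) (b' l) powr p"
        using powr_add_le_scaled[OF p nonneg nonneg pos]
        by (simp add: A_def B_def algebra_simps)
      finally show ?thesis using u kl by (simp add: mult_left_mono)
    next
      case False
      then show ?thesis using kl by (simp add: u_def)
    qed
  qed
  also have "\<dots> = A * (\<Sum>k\<in>I. w k * d (a k) (b k) powr p) + B * (\<Sum>l\<in>J. v l * d (a' l) (b' l) powr p)"
    using glue(2)[of "\<lambda>k. A * d (a k) (b k) powr p"] glue(3)[of "\<lambda>l. B * d (a' l) (b' l) powr p"]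
    by (simp add: distrib_left sum.distrib sum_distrib_left mult.left_commute)
  also have "\<dots> \<le> A * \<alpha> powr p + B * \<beta> powr p"
    using AB cost by (intro add_mono mult_left_mono)
  finally show ?thesis using AB by simp
qed

lemma wasserstein_triangle:
  assumes p: "p \<ge> 1" and fin: "\<mu> \<in> fin_prob M d" "\<nu> \<in> fin_prob M d" "\<rho> \<in> fin_prob M d"
  shows "wasserstein p M d \<mu> \<rho> \<le> wasserstein p M d \<mu> \<nu> + wasserstein p M d \<nu> \<rho>"
proof (rule field_le_epsilon)
  fix e :: real assume e: "0 < e"
  have p0: "p > 0" using p by simp
  \<comment> \<open>The slack makes both numbers positive and strictly larger than the distances, so
    near-optimal plans exist.\<close>
  define \<alpha> \<beta> where "\<alpha> = wasserstein p M d \<mu> \<nu> + e / 2" and "\<beta> = wasserstein p M d \<nu> \<rho> + e / 2"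
  have pos: "0 < \<alpha>" "0 < \<beta>"
    using e wasserstein_nonneg[of p] by (auto simp: \<alpha>_def \<beta>_def add_nonneg_pos)
  have lt: "wasserstein p M d \<mu> \<nu> powr p < \<alpha> powr p" "wasserstein p M d \<nu> \<rho> powr p < \<beta> powr p"
    using e p0 wasserstein_nonneg[of p] by (auto simp: \<alpha>_def \<beta>_def intro!: powr_less_mono2)
  obtain w where w: "plan (mass_support \<mu> \<times> mass_support \<nu>) w fst snd \<mu> \<nu>"
    "(\<Sum>z\<in>mass_support \<mu> \<times> mass_support \<nu>. w z * d (fst z) (snd z) powr p) < \<alpha> powr p"
    using wasserstein_support_plan[OF p0 fin(1,2) lt(1)] by blast
  obtain v where v: "plan (mass_support \<nu> \<times> mass_support \<rho>) v fst snd \<nu> \<rho>"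
    "(\<Sum>z\<in>mass_support \<nu> \<times> mass_support \<rho>. v z * d (fst z) (snd z) powr p) < \<beta> powr p"
    using wasserstein_support_plan[OF p0 fin(2,3) lt(2)] by blast
  have "wasserstein p M d \<mu> \<rho> powr p \<le> (\<alpha> + \<beta>) powr p"
    using plan_triangle[OF p w(1) v(1) fin(1,3) pos] w(2) v(2) by simp
  then have "wasserstein p M d \<mu> \<rho> \<le> \<alpha> + \<beta>"
    using p0 pos wasserstein_nonneg[of p \<mu> \<rho>] powr_less_mono2[of p "\<alpha> + \<beta>" "wasserstein p M d \<mu> \<rho>"]
    by (meson add_pos_pos less_imp_le not_le)
  then show "wasserstein p M d \<mu> \<rho> \<le> wasserstein p M d \<mu> \<nu> + wasserstein p M d \<nu> \<rho> + e"
    by (simp add: \<alpha>_def \<beta>_def)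
qed

section \<open>Compatibility with convex combinations, and the Dirac embedding\<close>

lemma wasserstein_cc_measure:
  assumes p: "p > 0" and r: "r \<in> {0..1}"
    and fin: "\<mu> \<in> fin_prob M d" "\<nu> \<in> fin_prob M d" "\<mu>' \<in> fin_prob M d" "\<nu>' \<in> fin_prob M d"
  shows "wasserstein p M d (cc_measure r \<mu> \<nu>) (cc_measure r \<mu>' \<nu>') powr p
    \<le> r * wasserstein p M d \<mu> \<mu>' powr p + (1 - r) * wasserstein p M d \<nu> \<nu>' powr p"
proof (rule field_le_epsilon)
  fix e :: real assume e: "0 < e"
  \<comment> \<open>Common carriers give both plans the same index set, so that their weights can be
    mixed pointwise.\<close>
  define S T where "S = mass_support \<mu> \<union> mass_support \<nu>" and "T = mass_support \<mu>' \<union> mass_support \<nu>'"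
  have S: "finite S" "mass_support \<mu> \<subseteq> S" "mass_support \<nu> \<subseteq> S" "S \<subseteq> M"
    and T: "finite T" "mass_support \<mu>' \<subseteq> T" "mass_support \<nu>' \<subseteq> T" "T \<subseteq> M"
    using fin finite_mass_support mass_support_subset by (auto simp: S_def T_def)
  let ?c = "wasserstein p M d \<mu> \<mu>' powr p + e" and ?c' = "wasserstein p M d \<nu> \<nu>' powr p + e"
  obtain w where w: "plan (S \<times> T) w fst snd \<mu> \<mu>'" "(\<Sum>z\<in>S \<times> T. w z * d (fst z) (snd z) powr p) < ?c"
    using wasserstein_plan[OF p fin(1,3) S(1,2,4) T(1,2,4), of ?c] e by auto
  obtain v where v: "plan (S \<times> T) v fst snd \<nu> \<nu>'" "(\<Sum>z\<in>S \<times> T. v z * d (fst z) (snd z) powr p) < ?c'"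
    using wasserstein_plan[OF p fin(2,4) S(1,3,4) T(1,3,4), of ?c'] e by auto
  have "plan (S \<times> T) (\<lambda>z. r * w z + (1 - r) * v z) fst snd (cc_measure r \<mu> \<nu>) (cc_measure r \<mu>' \<nu>')"
    using w(1) v(1) r fin unfolding plan_def
    by (auto simp: sum.distrib sum_distrib_left[symmetric] measure_cc_measure finite_sets_mborel)
  then have "wasserstein p M d (cc_measure r \<mu> \<nu>) (cc_measure r \<mu>' \<nu>') powr p
      \<le> (\<Sum>z\<in>S \<times> T. (r * w z + (1 - r) * v z) * d (fst z) (snd z) powr p)"
    using p r fin by (intro plan_wasserstein fin_prob_cc_measure)
  also have "\<dots> = r * (\<Sum>z\<in>S \<times> T. w z * d (fst z) (snd z) powr p)
      + (1 - r) * (\<Sum>z\<in>S \<times> T. v z * d (fst z) (snd z) powr p)"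
    by (simp only: sum_distrib_left sum.distrib[symmetric]) (simp add: algebra_simps)
  also have "\<dots> \<le> r * ?c + (1 - r) * ?c'"
    using r w(2) v(2) by (intro add_mono mult_left_mono) auto
  also have "\<dots> = r * wasserstein p M d \<mu> \<mu>' powr p + (1 - r) * wasserstein p M d \<nu> \<nu>' powr p + e"
    by (simp add: algebra_simps)
  finally show "wasserstein p M d (cc_measure r \<mu> \<nu>) (cc_measure r \<mu>' \<nu>') powr p
      \<le> r * wasserstein p M d \<mu> \<mu>' powr p + (1 - r) * wasserstein p M d \<nu> \<nu>' powr p + e" .
qed

lemma wasserstein_algebra_fin_prob:
  assumes p: "p \<ge> 1"
  shows "wasserstein_algebra p (fin_prob M d) (wasserstein p M d) cc_measure"
proof -
  interpret W: Metric_space "fin_prob M d" "wasserstein p M d"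
    by unfold_locales
      (use p in \<open>auto simp: wasserstein_nonneg wasserstein_commute wasserstein_self wasserstein_triangle
        intro: wasserstein_eq_0[of p]\<close>)
  interpret B: barycentric_algebra "fin_prob M d" cc_measure by (rule barycentric_fin_prob)
  show ?thesis
  proof
    show "wasserstein p M d (cc_measure r \<mu> \<nu>) (cc_measure r \<mu>' \<nu>') powr p
        \<le> r * wasserstein p M d \<mu> \<mu>' powr p + (1 - r) * wasserstein p M d \<nu> \<nu>' powr p"
      if "r \<in> {0..1}" "\<mu> \<in> fin_prob M d" "\<nu> \<in> fin_prob M d" "\<mu>' \<in> fin_prob M d" "\<nu>' \<in> fin_prob M d"
      for r \<mu> \<nu> \<mu>' \<nu>'
      using p that by (intro wasserstein_cc_measure) auto
    note cc = this
    fix r :: real assume r: "r \<in> {0..1}"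
    have "wasserstein p M d (cc_measure r \<mu> \<nu>) (cc_measure r \<mu>' \<nu>')
        \<le> max (wasserstein p M d \<mu> \<mu>') (wasserstein p M d \<nu> \<nu>')" (is "?l \<le> ?m")
      if "\<mu> \<in> fin_prob M d" "\<nu> \<in> fin_prob M d" "\<mu>' \<in> fin_prob M d" "\<nu>' \<in> fin_prob M d" for \<mu> \<nu> \<mu>' \<nu>'
    proof -
      have m: "0 \<le> ?m" by (simp add: le_max_iff_disj)
      \<comment> \<open>Both distances are at most their maximum, and the weights \<open>r\<close>
        and \<open>1 - r\<close> add up to 1: the Wasserstein inequality yields
        nonexpansiveness.\<close>
      have "?l powr p \<le> r * ?m powr p + (1 - r) * ?m powr p"
        using p r by (intro order_trans[OF cc[OF r that]] add_mono mult_left_mono powr_mono2) auto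
      then have "?l powr p \<le> ?m powr p" by (simp add: algebra_simps)
      then show ?thesis
        using p m powr_less_mono2[of p ?m ?l] by (meson le_less_trans not_le less_le_trans zero_less_one)
    qed
    then show "nonexpansive_map (fin_prob M d \<times> fin_prob M d)
        (\<lambda>(\<mu>, \<nu>) (\<mu>', \<nu>'). max (wasserstein p M d \<mu> \<mu>') (wasserstein p M d \<nu> \<nu>'))
        (fin_prob M d) (wasserstein p M d) (\<lambda>(\<mu>, \<nu>). cc_measure r \<mu> \<nu>)"
      using r by (auto simp: nonexpansive_map_def B.closed)
  qed
qed

text \<open>One transport from \<open>x\<close> to \<open>y\<close> gives the upper bound.
  Conversely, on the carriers \<open>{x}\<close> and \<open>{y}\<close> a plan has a single pair,
  which must carry weight 1, so no plan is cheaper.\<close>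

lemma wasserstein_dirac:
  assumes p: "p > 0" and xy: "x \<in> M" "y \<in> M"
  shows "wasserstein p M d (dirac M d x) (dirac M d y) = d x y"
proof -
  have fin: "dirac M d x \<in> fin_prob M d" "dirac M d y \<in> fin_prob M d" using xy fin_prob_dirac by auto
  have supp: "mass_support (dirac M d z) \<subseteq> {z}" if "z \<in> M" for z
    using that by (auto simp: mass_support_def measure_dirac split: if_splits)
  let ?W = "wasserstein p M d (dirac M d x) (dirac M d y)"
  have "plan {()} (\<lambda>_. 1) (\<lambda>_. x) (\<lambda>_. y) (dirac M d x) (dirac M d y)"
    using xy by (auto simp: plan_def measure_dirac Collect_conv_if)
  then have "?W powr p \<le> d x y powr p"
    using plan_wasserstein[OF p _ fin] by fastforce
  moreover have "\<not> ?W powr p < d x y powr p"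
  proof
    assume "?W powr p < d x y powr p"
    then obtain w where w: "plan ({x} \<times> {y}) w fst snd (dirac M d x) (dirac M d y)"
      "(\<Sum>z\<in>{x} \<times> {y}. w z * d (fst z) (snd z) powr p) < d x y powr p"
      using wasserstein_plan[OF p fin _ supp[OF xy(1)] _ _ supp[OF xy(2)]] xy by auto
    then show False using sum_plan[OF w(1) fin(1)] by simp
  qed
  ultimately have "?W powr p = d x y powr p" by simp
  then show ?thesis
    using p wasserstein_nonneg[of p] nonneg[of x y]
    by (metis less_irrefl linorder_neqE_linordered_idom powr_less_mono2)
qed

end

section \<open>The universal property\<close>

context Metric_space
begin

lemma measure_weighted_id:
  assumes "finite S" "\<forall>x\<in>S. 0 \<le> w x" "S \<subseteq> M" "x \<in> M"
  shows "measure (weighted_measure S w (\<lambda>x. x) (mborel M d)) {x} = (if x \<in> S then w x else 0)"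
proof -
  have "{k\<in>S. k = x} = (if x \<in> S then {x} else {})" by auto
  moreover have "(\<lambda>x. x) \<in> S \<rightarrow> M" using assms by auto
  ultimately show ?thesis using assms by (simp add: measure_weighted_singleton)
qed

lemma weighted_measure_masses:
  assumes "\<mu> \<in> fin_prob M d"
  shows "weighted_measure (mass_support \<mu>) (\<lambda>x. measure \<mu> {x}) (\<lambda>x. x) (mborel M d) = \<mu>"
  using assms finite_mass_support[OF assms] mass_support_subset[of \<mu>] sum_masses[OF assms]
  by (intro fin_prob_eqI weighted_measure_fin_prob)
    (auto simp: measure_weighted_id, auto simp: mass_support_def)

text \<open>One atom is peeled off and the rest renormalised by \<open>1 - w x\<close>. This
  exhibits every finite combination as an iterated binary one, on which an affine map can be
  evaluated.\<close>

lemma weighted_measure_insert: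
  assumes "finite S" "x \<notin> S" "insert x S \<subseteq> M" "\<forall>y\<in>insert x S. 0 \<le> w y" "sum w (insert x S) = 1" "w x \<noteq> 1"
  shows "w x \<in> {0..1}" "sum (\<lambda>y. w y / (1 - w x)) S = 1" "\<forall>y\<in>S. 0 \<le> w y / (1 - w x)"
    "weighted_measure (insert x S) w (\<lambda>x. x) (mborel M d)
      = cc_measure (w x) (dirac M d x) (weighted_measure S (\<lambda>y. w y / (1 - w x)) (\<lambda>x. x) (mborel M d))"
proof -
  have "sum w S = 1 - w x" "0 \<le> sum w S" using assms by (auto intro: sum_nonneg)
  then have lt: "w x < 1" using assms(6) by simp
  show wx: "w x \<in> {0..1}" using assms lt by auto
  show one: "sum (\<lambda>y. w y / (1 - w x)) S = 1"
    using \<open>sum w S = 1 - w x\<close> lt by (simp add: sum_divide_distrib[symmetric])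
  show nn: "\<forall>y\<in>S. 0 \<le> w y / (1 - w x)" using assms lt by simp
  let ?\<nu> = "weighted_measure S (\<lambda>y. w y / (1 - w x)) (\<lambda>x. x) (mborel M d)"
  have \<nu>: "?\<nu> \<in> fin_prob M d"
    using assms one nn by (intro weighted_measure_fin_prob) auto
  have x: "x \<in> M" using assms by auto
  show "weighted_measure (insert x S) w (\<lambda>x. x) (mborel M d) = cc_measure (w x) (dirac M d x) ?\<nu>"
  proof (rule fin_prob_eqI)
    show "weighted_measure (insert x S) w (\<lambda>x. x) (mborel M d) \<in> fin_prob M d"
      using assms by (intro weighted_measure_fin_prob) auto
    show "cc_measure (w x) (dirac M d x) ?\<nu> \<in> fin_prob M d"
      by (intro fin_prob_cc_measure wx \<nu> fin_prob_dirac x)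
    fix y assume y: "y \<in> M"
    have "measure (weighted_measure (insert x S) w (\<lambda>x. x) (mborel M d)) {y}
        = (if y \<in> insert x S then w y else 0)"
      using assms y by (intro measure_weighted_id) auto
    moreover have "measure ?\<nu> {y} = (if y \<in> S then w y / (1 - w x) else 0)"
      using assms y nn by (intro measure_weighted_id) auto
    moreover have "measure (cc_measure (w x) (dirac M d x) ?\<nu>) {y}
        = w x * measure (dirac M d x) {y} + (1 - w x) * measure ?\<nu> {y}"
      using wx \<nu> x y by (intro measure_cc_measure fin_prob_dirac finite_sets_mborel) auto
    ultimately show "measure (weighted_measure (insert x S) w (\<lambda>x. x) (mborel M d)) {y}
        = measure (cc_measure (w x) (dirac M d x) ?\<nu>) {y}"
      using assms lt x y by (auto simp: measure_dirac)
  qed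
qed

lemma affine_map_eq:
  assumes g: "affine_map (fin_prob M d) cc_measure A cc g" and h: "affine_map (fin_prob M d) cc_measure A cc h"
    and eq: "\<And>x. x \<in> M \<Longrightarrow> g (dirac M d x) = h (dirac M d x)"
    and \<mu>: "\<mu> \<in> fin_prob M d"
  shows "g \<mu> = h \<mu>"
proof -
  have "g (weighted_measure S w (\<lambda>x. x) (mborel M d)) = h (weighted_measure S w (\<lambda>x. x) (mborel M d))"
    if "finite S" "S \<subseteq> M" "\<forall>x\<in>S. 0 \<le> w x" "sum w S = 1" for S w
    using that
  \<comment> \<open>The weights are generalised because the induction hypothesis is applied to the
    rescaled ones.\<close>
  proof (induction S arbitrary: w)
    case (insert x S)
    have x: "x \<in> M" "insert x S \<subseteq> M" using insert.prems by auto
    show ?case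
    proof (cases "w x = 1")
      \<comment> \<open>Renormalising would divide by 0; instead all other weights vanish and only
        the Dirac measure at \<open>x\<close> is left.\<close>
      case True
      then have "sum w S = 0" using insert by simp
      then have zero: "\<forall>y\<in>S. w y = 0" using insert by (simp add: sum_nonneg_eq_0_iff)
      have "weighted_measure (insert x S) w (\<lambda>x. x) (mborel M d) = dirac M d x"
      proof (rule fin_prob_eqI)
        show "weighted_measure (insert x S) w (\<lambda>x. x) (mborel M d) \<in> fin_prob M d"
          using insert by (intro weighted_measure_fin_prob) auto
        fix y assume y: "y \<in> M"
        have "measure (weighted_measure (insert x S) w (\<lambda>x. x) (mborel M d)) {y}
            = (if y \<in> insert x S then w y else 0)"
          using insert y by (intro measure_weighted_id) auto
        then show "measure (weighted_measure (insert x S) w (\<lambda>x. x) (mborel M d)) {y}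
            = measure (dirac M d x) {y}"
          using True zero x y by (auto simp: measure_dirac)
      qed (rule fin_prob_dirac[OF x(1)])
      then show ?thesis using eq x by simp
    next
      case False
      note decomp = weighted_measure_insert[OF insert.hyps insert.prems False]
      let ?\<nu> = "weighted_measure S (\<lambda>y. w y / (1 - w x)) (\<lambda>x. x) (mborel M d)"
      have "?\<nu> \<in> fin_prob M d"
        using insert.hyps x decomp by (intro weighted_measure_fin_prob) auto
      moreover have "g ?\<nu> = h ?\<nu>" using x decomp by (intro insert.IH) auto
      ultimately show ?thesis
        using g h eq x decomp(1) fin_prob_dirac unfolding decomp(4) by (simp add: affine_map_def)
    qed
  qed simp
  from this[OF finite_mass_support[OF \<mu>] mass_support_subset, of "\<lambda>x. measure \<mu> {x}"] show ?thesis
    using sum_masses[OF \<mu> finite_mass_support[OF \<mu>] order_refl mass_support_subset]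
    by (simp add: weighted_measure_masses[OF \<mu>])
qed

end

section \<open>Existence: extension of a map by barycentres\<close>

locale affine_extension = X: Metric_space M d + barycentric_algebra A cc
  for M :: "'x set" and d and A :: "'a set" and cc +
  fixes f :: "'x \<Rightarrow> 'a"
  assumes f: "f \<in> M \<rightarrow> A"
begin

text \<open>The barycentre in \<open>A\<close> of the masses of \<mu> moved along \<open>f\<close>.
  Summing over the atoms makes it a function of the measure, not of a presentation as a convex
  combination.\<close>

definition ext :: "'x measure \<Rightarrow> 'a" where
  "ext \<mu> = snd (finprod mass_cone (\<lambda>x. weighted (measure \<mu> {x}) (f x)) (X.mass_support \<mu>))"

lemma weighted_masses_funcset:
  "S \<subseteq> M \<Longrightarrow> (\<lambda>x. weighted (measure \<mu> {x}) (f x)) \<in> S \<rightarrow> carrier mass_cone"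
  using f by (intro weighted_funcset) auto

text \<open>Points outside the support contribute neutral summands. The first component is the total
  mass 1, so keeping only the position in \<open>ext\<close> loses nothing.\<close>

lemma finprod_masses:
  assumes "\<mu> \<in> fin_prob M d" "finite S" "X.mass_support \<mu> \<subseteq> S" "S \<subseteq> M"
  shows "finprod mass_cone (\<lambda>x. weighted (measure \<mu> {x}) (f x)) S = (1, ext \<mu>)"
proof -
  let ?g = "\<lambda>x. weighted (measure \<mu> {x}) (f x)"
  have P: "?g \<in> S \<rightarrow> carrier mass_cone" by (rule weighted_masses_funcset[OF assms(4)])
  have "finprod mass_cone ?g (X.mass_support \<mu>) = finprod mass_cone ?g S"
    using assms P by (intro mass_cone.finprod_mono_neutral_cong_left)
      (auto simp: X.mass_support_def weighted_zero)
  then have "snd (finprod mass_cone ?g S) = ext \<mu>" by (simp add: ext_def)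
  moreover have "fst (finprod mass_cone ?g S) = 1"
    using assms P by (simp add: fst_finprod X.sum_masses)
  ultimately show ?thesis by (metis prod.collapse)
qed

lemma ext_closed:
  assumes "\<mu> \<in> fin_prob M d"
  shows "ext \<mu> \<in> A"
proof -
  have "(1, ext \<mu>) \<in> carrier mass_cone"
    using finprod_masses[OF assms X.finite_mass_support[OF assms] order_refl X.mass_support_subset]
      mass_cone.finprod_closed[OF weighted_masses_funcset[OF X.mass_support_subset]] by metis
  then show ?thesis by (simp add: carrier_mass_cone)
qed

text \<open>Any presentation of \<mu> with repeated points yields the same barycentre, by
  regrouping. It is applied to both ends of a plan.\<close>

lemma finprod_marginal:
  assumes "finite I" "\<forall>k\<in>I. 0 \<le> w k" "a \<in> I \<rightarrow> M"
    and mass: "\<And>x. x \<in> M \<Longrightarrow> (\<Sum>k\<in>{k\<in>I. a k = x}. w k) = measure \<mu> {x}"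
    and \<mu>: "\<mu> \<in> fin_prob M d"
  shows "finprod mass_cone (\<lambda>k. weighted (w k) (f (a k))) I = (1, ext \<mu>)"
proof -
  let ?S = "X.mass_support \<mu> \<union> a ` I"
  have S: "finite ?S" "?S \<subseteq> M"
    using assms X.finite_mass_support X.mass_support_subset by auto
  have "f \<in> ?S \<rightarrow> A" "a \<in> I \<rightarrow> ?S" using f S(2) by auto
  then have "finprod mass_cone (\<lambda>k. weighted (w k) (f (a k))) I
      = finprod mass_cone (\<lambda>x. weighted (\<Sum>k\<in>{k\<in>I. a k = x}. w k) (f x)) ?S"
    by (intro finprod_weighted_group assms(1,2) S(1))
  also have "\<dots> = finprod mass_cone (\<lambda>x. weighted (measure \<mu> {x}) (f x)) ?S"
    using S(2) mass by (intro mass_cone.finprod_cong' weighted_masses_funcset) auto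
  also have "\<dots> = (1, ext \<mu>)" using S by (intro finprod_masses \<mu>) auto
  finally show ?thesis .
qed

lemma ext_dirac:
  assumes "x \<in> M"
  shows "ext (dirac M d x) = f x"
proof -
  have "X.mass_support (dirac M d x) = {x}"
    using assms by (auto simp: X.mass_support_def X.measure_dirac split: if_splits)
  moreover have "f x \<in> A" using f assms by auto
  ultimately show ?thesis
    using assms by (simp add: ext_def X.measure_dirac) (simp add: weighted_def)
qed

lemma ext_cc_measure:
  assumes r: "r \<in> {0..1}" and \<mu>: "\<mu> \<in> fin_prob M d" and \<nu>: "\<nu> \<in> fin_prob M d"
  shows "ext (cc_measure r \<mu> \<nu>) = cc r (ext \<mu>) (ext \<nu>)"
proof -
  let ?S = "X.mass_support \<mu> \<union> X.mass_support \<nu>"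
  have S: "finite ?S" "?S \<subseteq> M"
    using \<mu> \<nu> X.finite_mass_support X.mass_support_subset by auto
  have cc: "measure (cc_measure r \<mu> \<nu>) {x} = r * measure \<mu> {x} + (1 - r) * measure \<nu> {x}" if "x \<in> M" for x
    using that r \<mu> \<nu> by (intro X.measure_cc_measure X.finite_sets_mborel) auto
  have supp: "X.mass_support (cc_measure r \<mu> \<nu>) \<subseteq> ?S"
  proof
    fix x assume "x \<in> X.mass_support (cc_measure r \<mu> \<nu>)"
    then show "x \<in> ?S" using cc[of x] by (auto simp: X.mass_support_def)
  qed
  have P: "(\<lambda>x. weighted (s * measure \<rho> {x}) (f x)) \<in> ?S \<rightarrow> carrier mass_cone" if "0 \<le> s" for s and \<rho> :: "'x measure"
    using that f S(2) by (intro weighted_funcset) auto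
  \<comment> \<open>Scaling the sum \<open>(1, ext \<rho>)\<close> by \<open>s\<close> is scaling
    each summand, which pulls the coefficient out.\<close>
  have scaled: "finprod mass_cone (\<lambda>x. weighted (s * measure \<rho> {x}) (f x)) ?S = weighted s (ext \<rho>)"
    if "0 \<le> s" "\<rho> \<in> fin_prob M d" "X.mass_support \<rho> \<subseteq> ?S" for s \<rho>
    using scale_finprod[OF that(1) S(1) weighted_masses_funcset[OF S(2)], of \<rho>]
      finprod_masses[OF that(2) S(1) that(3) S(2)]
    by (simp add: scale_weighted) (simp add: scale_def)
  have "(1, ext (cc_measure r \<mu> \<nu>)) = finprod mass_cone (\<lambda>x. weighted (measure (cc_measure r \<mu> \<nu>) {x}) (f x)) ?S"
    using S supp by (intro finprod_masses[symmetric] X.fin_prob_cc_measure r \<mu> \<nu>)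
  also have "\<dots> = finprod mass_cone (\<lambda>x. weighted (r * measure \<mu> {x}) (f x) \<otimes>\<^bsub>mass_cone\<^esub>
      weighted ((1 - r) * measure \<nu> {x}) (f x)) ?S"
  proof (rule mass_cone.finprod_cong'[OF refl])
    fix x assume "x \<in> ?S"
    then have "x \<in> M" "f x \<in> A" using S(2) f by auto
    then show "weighted (measure (cc_measure r \<mu> \<nu>) {x}) (f x)
        = weighted (r * measure \<mu> {x}) (f x) \<otimes>\<^bsub>mass_cone\<^esub> weighted ((1 - r) * measure \<nu> {x}) (f x)"
      using r by (simp add: cc weighted_add)
  qed (use r P[of r \<mu>] P[of "1 - r" \<nu>] in \<open>auto simp: Pi_iff\<close>)
  also have "\<dots> = weighted r (ext \<mu>) \<otimes>\<^bsub>mass_cone\<^esub> weighted (1 - r) (ext \<nu>)"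
    using r \<mu> \<nu> P[of r \<mu>] P[of "1 - r" \<nu>] by (simp add: scaled)
  also have "\<dots> = (1, cc r (ext \<mu>) (ext \<nu>))"
    using r \<mu> \<nu> by (intro weighted_cc ext_closed)
  finally show ?thesis by simp
qed

lemma affine_map_ext: "affine_map (fin_prob M d) cc_measure A cc ext"
  by (auto simp: affine_map_def ext_closed ext_cc_measure)

lemma nonexpansive_map_ext:
  assumes p: "p \<ge> 1" and B: "wasserstein_algebra p A e cc" and f_nonexp: "nonexpansive_map M d A e f"
  shows "nonexpansive_map (fin_prob M d) (wasserstein p M d) A e ext"
proof -
  interpret W: wasserstein_algebra p A e cc by (rule B)
  have "e (ext \<mu>) (ext \<nu>) \<le> wasserstein p M d \<mu> \<nu>"
    if fin: "\<mu> \<in> fin_prob M d" "\<nu> \<in> fin_prob M d" for \<mu> \<nu>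
  proof (rule ccontr)
    assume "\<not> e (ext \<mu>) (ext \<nu>) \<le> wasserstein p M d \<mu> \<nu>"
    then have "wasserstein p M d \<mu> \<nu> powr p < e (ext \<mu>) (ext \<nu>) powr p"
      using p X.wasserstein_nonneg[of p \<mu> \<nu>] by (intro powr_less_mono2) auto
    then obtain w where plan: "X.plan (X.mass_support \<mu> \<times> X.mass_support \<nu>) w fst snd \<mu> \<nu>" (is "X.plan ?F _ _ _ _ _")
      and cost: "(\<Sum>z\<in>X.mass_support \<mu> \<times> X.mass_support \<nu>. w z * d (fst z) (snd z) powr p)
        < e (ext \<mu>) (ext \<nu>) powr p"
      using X.wasserstein_support_plan[of p \<mu> \<nu>] p fin by fastforce
    have F: "finite ?F" "\<forall>z\<in>?F. 0 \<le> w z" "fst \<in> ?F \<rightarrow> M" "snd \<in> ?F \<rightarrow> M"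
      using plan by (simp_all add: X.plan_def)
    have "finprod mass_cone (\<lambda>z. weighted (w z) (f (fst z))) ?F = (1, ext \<mu>)"
      using plan by (intro finprod_marginal F fin) (simp add: X.plan_def)
    moreover have "finprod mass_cone (\<lambda>z. weighted (w z) (f (snd z))) ?F = (1, ext \<nu>)"
      using plan by (intro finprod_marginal F fin) (simp add: X.plan_def)
    moreover have "(\<lambda>z. f (fst z)) \<in> ?F \<rightarrow> A" "(\<lambda>z. f (snd z)) \<in> ?F \<rightarrow> A"
      using F f by (auto simp: Pi_iff)
    ultimately have "e (ext \<mu>) (ext \<nu>) powr p \<le> (\<Sum>z\<in>?F. w z * e (f (fst z)) (f (snd z)) powr p)"
      using W.dist_finprod_weighted[of ?F w "\<lambda>z. f (fst z)" "\<lambda>z. f (snd z)"] F(1,2)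
        X.sum_plan[OF plan fin(1)] by simp
    also have "\<dots> \<le> (\<Sum>z\<in>?F. w z * d (fst z) (snd z) powr p)"
    proof (intro sum_mono mult_left_mono powr_mono2)
      fix z assume "z \<in> ?F"
      then have "fst z \<in> M" "snd z \<in> M" using F by auto
      then show "e (f (fst z)) (f (snd z)) \<le> d (fst z) (snd z)"
        using f_nonexp by (simp add: nonexpansive_map_def)
    qed (use p F in auto)
    finally show False using cost by simp
  qed
  then show ?thesis by (auto simp: nonexpansive_map_def ext_closed)
qed

end

theorem theorem3p3:
  fixes X :: "'a set" and d :: "'a \<Rightarrow> 'a \<Rightarrow> real" and p :: real
  assumes "Metric_space X d" and "p \<ge> 1"
  shows "wasserstein_algebra p (fin_prob X d) (wasserstein p X d) cc_measure
    \<and> nonexpansive_map X d (fin_prob X d) (wasserstein p X d) (dirac X d)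
    \<and> isometric_embedding X d (fin_prob X d) (wasserstein p X d) (dirac X d)
    \<and> (\<forall>(B :: 'b set) e cc f.
         wasserstein_algebra p B e cc \<longrightarrow> nonexpansive_map X d B e f \<longrightarrow>
         (\<exists>!g. g \<in> fin_prob X d \<rightarrow>\<^sub>E B
             \<and> nonexpansive_map (fin_prob X d) (wasserstein p X d) B e g
             \<and> affine_map (fin_prob X d) cc_measure B cc g
             \<and> (\<forall>x\<in>X. g (dirac X d x) = f x)))"
proof (intro conjI allI impI)
  interpret X: Metric_space X d by (rule assms)
  show "wasserstein_algebra p (fin_prob X d) (wasserstein p X d) cc_measure"
    by (rule X.wasserstein_algebra_fin_prob[OF assms(2)])
  show "nonexpansive_map X d (fin_prob X d) (wasserstein p X d) (dirac X d)"
    "isometric_embedding X d (fin_prob X d) (wasserstein p X d) (dirac X d)"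
    using assms(2) by (auto simp: nonexpansive_map_def isometric_embedding_def
        X.fin_prob_dirac X.wasserstein_dirac)
  fix B :: "'b set" and e cc f
  assume B: "wasserstein_algebra p B e cc" and f: "nonexpansive_map X d B e f"
  interpret B: wasserstein_algebra p B e cc by (rule B)
  interpret E: affine_extension X d B cc f
    by unfold_locales (use f in \<open>simp add: nonexpansive_map_def\<close>)
  \<comment> \<open>Restriction fixes the values outside \<open>fin_prob X d\<close>, so that
    uniqueness holds as an equality of total functions.\<close>
  define g where "g = restrict E.ext (fin_prob X d)"
  show "\<exists>!g. g \<in> fin_prob X d \<rightarrow>\<^sub>E B
             \<and> nonexpansive_map (fin_prob X d) (wasserstein p X d) B e g
             \<and> affine_map (fin_prob X d) cc_measure B cc g
             \<and> (\<forall>x\<in>X. g (dirac X d x) = f x)"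
  proof (intro ex1I conjI ballI)
    show "g \<in> fin_prob X d \<rightarrow>\<^sub>E B"
      using E.ext_closed by (simp add: g_def)
    show "nonexpansive_map (fin_prob X d) (wasserstein p X d) B e g"
      using E.nonexpansive_map_ext[OF assms(2) B f] by (simp add: nonexpansive_map_def g_def Pi_iff)
    show "affine_map (fin_prob X d) cc_measure B cc g"
      using E.affine_map_ext X.fin_prob_cc_measure by (simp add: affine_map_def g_def Pi_iff)
    show "g (dirac X d x) = f x" if "x \<in> X" for x
      using that by (simp add: g_def X.fin_prob_dirac E.ext_dirac)
    fix h assume h: "h \<in> fin_prob X d \<rightarrow>\<^sub>E B
             \<and> nonexpansive_map (fin_prob X d) (wasserstein p X d) B e h
             \<and> affine_map (fin_prob X d) cc_measure B cc h
             \<and> (\<forall>x\<in>X. h (dirac X d x) = f x)"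
    have "h \<mu> = E.ext \<mu>" if "\<mu> \<in> fin_prob X d" for \<mu>
      using h that by (intro X.affine_map_eq[of B cc h E.ext \<mu>] E.affine_map_ext) (auto simp: E.ext_dirac)
    then show "h = g"
      using h by (intro extensionalityI[of _ "fin_prob X d"]) (auto simp: g_def PiE_def)
  qed
qed

end
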